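(* Let $p>q\ge0$ be integers and let $\vec a\in(-1,\infty)^p$, $\vec b\in(-1,\infty)^q$ satisfy $a_j<b_j$ for $1\le j\le q$. Let $\vec n\in\mathbb Z_{\ge0}^q$ and $\vec m\in\mathbb Z_{\ge0}^{p-q}$ be such that $\vec n\sqcup\vec m$ is near the diagonal, $\vec m$ is on the step-line, and $|\vec n|+|\vec m|\ge1$. Then every type I function $F_{\vec n\sqcup\vec m}$ for the weights $(w_1,\dots,w_q,v_1,\dots,v_{p-q})$ on $(0,\infty)$ has a Mellin transform of the form $$\int_0^\infty F_{\vec n\sqcup\vec m}(x)x^{s-1}dx=\mathcal F_{\vec n\sqcup\vec m}\cdot\frac{\Gamma(s+\vec a)}{\Gamma(s+\vec b+\vec n)}\,(1-s)_{|\vec n|+|\vec m|-1}$$ for some constant $\mathcal F_{\vec n\sqcup\vec m}\in\mathbb R$.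
   Context: Conventions: for a vector $\vec s$, $\Gamma(\vec s)=\prod_j\Gamma(s_j)$; adding a scalar to a vector means adding it to each component; $(s)_k=\prod_{i=0}^{k-1}(s+i)$; $|\vec n|$ is the sum of the components; $\vec e_j$ is the $j$-th unit vector; $\vec n\sqcup\vec m=(n_1,\dots,n_q,m_1,\dots,m_{p-q})$. A multi-index $\vec k$ is near the diagonal if $|k_i-k_j|\le1$ for all $i,j$; $\vec m\in\mathbb Z_{\ge0}^{p-q}$ is on the step-line if $m_1\ge m_2\ge\dots\ge m_{p-q}\ge m_1-1$. Weights: let $\mathcal B^{a,b}(x)=x^a(1-x)^{b-a-1}/\Gamma(b-a)$ on $(0,1)$ and $\mathcal G^a(x)=x^ae^{-x}$ on $(0,\infty)$. Let $w_0(x;\vec a,\vec b)$ be the Mellin convolution of $\mathcal B^{a_j,b_j}$ ($1\le j\le q$) and $\mathcal G^{a_j}$ ($q+1\le j\le p$), where $(f\ast g)(x)=\int_0^\infty f(t)g(x/t)dt/t$; its Mellin transform $\int_0^\infty x^{s-1}w_0\,dx$ is $\Gamma(s+\vec a)/\Gamma(s+\vec b)$. Put $w_j(x)=w_0(x;\vec a,\vec b+\vec e_j)$ for $1\le j\le q$, with Mellin transform $\Gamma(s+\vec a)/\Gamma(s+\vec b+\vec e_j)$. Put $v_1=w_0(\cdot;\vec a,\vec b)$ and $v_{j+1}(x)=-\frac{d}{dx}[x\,v_j(x)]$, so that $v_j$ has Mellin transform $\frac{\Gamma(s+\vec a)}{\Gamma(s+\vec b)}(s-1)^{j-1}$, $1\le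 j\le p-q$. Mellin transforms are considered for $\mathrm{Re}\,s>-\min_ja_j$. Type I function for $\vec n\sqcup\vec m$: $F_{\vec n\sqcup\vec m}=\sum_{j=1}^qA_jw_j+\sum_{j=1}^{p-q}A_{q+j}v_j$ with real polynomials $\deg A_j\le n_j-1$, $\deg A_{q+j}\le m_j-1$ (a polynomial is $0$ if its bound is $-1$) such that $\int_0^\infty F_{\vec n\sqcup\vec m}(x)x^kdx=0$ for $k=0,\dots,|\vec n|+|\vec m|-2$. *)

theory Defs
  imports "HOL-Analysis.Analysis" "HOL-Computational_Algebra.Polynomial"
begin

text \<open>
  Vectors are functions on \<open>nat\<close> of which only the entries with index in \<open>{1..d}\<close> matter,
  \<open>d\<close> being the dimension. Functions on \<open>(0,1)\<close> and \<open>(0,\<infinity>)\<close> are extended by zero.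
\<close>

definition beta_weight :: "real \<Rightarrow> real \<Rightarrow> real \<Rightarrow> real" where
  "beta_weight a b x =
     (if 0 < x \<and> x < 1 then x powr a * (1 - x) powr (b - a - 1) / Gamma (b - a) else 0)"

definition gamma_weight :: "real \<Rightarrow> real \<Rightarrow> real" where
  "gamma_weight a x = (if 0 < x then x powr a * exp (- x) else 0)"

definition mellin_conv :: "(real \<Rightarrow> real) \<Rightarrow> (real \<Rightarrow> real) \<Rightarrow> real \<Rightarrow> real" where
  "mellin_conv f g x = (LBINT t:{0<..}. f t * g (x / t) / t)"

text \<open>
  Mellin convolution is commutative and associative on the weights above, so the bracketing to
  the right is only a choice of representative. The value on the empty list is never used.
\<close>

fun mellin_conv_list :: "(real \<Rightarrow> real) list \<Rightarrow> real \<Rightarrow> real" where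
  "mellin_conv_list [] = (\<lambda>x. 0)"
| "mellin_conv_list [f] = f"
| "mellin_conv_list (f # g # fs) = mellin_conv f (mellin_conv_list (g # fs))"

definition w0 :: "nat \<Rightarrow> nat \<Rightarrow> (nat \<Rightarrow> real) \<Rightarrow> (nat \<Rightarrow> real) \<Rightarrow> real \<Rightarrow> real" where
  "w0 p q a b = mellin_conv_list
     (map (\<lambda>j. beta_weight (a j) (b j)) [1..<q+1] @ map (\<lambda>j. gamma_weight (a j)) [q+1..<p+1])"

definition w_weight ::
  "nat \<Rightarrow> nat \<Rightarrow> (nat \<Rightarrow> real) \<Rightarrow> (nat \<Rightarrow> real) \<Rightarrow> nat \<Rightarrow> real \<Rightarrow> real" where
  "w_weight p q a b j = w0 p q a (b(j := b j + 1))"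

definition v_weight ::
  "nat \<Rightarrow> nat \<Rightarrow> (nat \<Rightarrow> real) \<Rightarrow> (nat \<Rightarrow> real) \<Rightarrow> nat \<Rightarrow> real \<Rightarrow> real" where
  "v_weight p q a b j = ((\<lambda>f x. - deriv (\<lambda>y. y * f y) x) ^^ (j - 1)) (w0 p q a b)"

text \<open>The multi-index \<open>n \<squnion> m\<close>, where \<open>n\<close> has length \<open>q\<close>.\<close>

definition join_index :: "nat \<Rightarrow> (nat \<Rightarrow> nat) \<Rightarrow> (nat \<Rightarrow> nat) \<Rightarrow> nat \<Rightarrow> nat" where
  "join_index q n m j = (if j \<le> q then n j else m (j - q))"

definition near_diagonal :: "nat \<Rightarrow> (nat \<Rightarrow> nat) \<Rightarrow> bool" where
  "near_diagonal d k \<longleftrightarrow> (\<forall>i\<in>{1..d}. \<forall>j\<in>{1..d}. \<bar>int (k i) - int (k j)\<bar> \<le> 1)"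

definition on_step_line :: "nat \<Rightarrow> (nat \<Rightarrow> nat) \<Rightarrow> bool" where
  "on_step_line d m \<longleftrightarrow> (\<forall>j\<in>{1..<d}. m j \<ge> m (j + 1)) \<and> int (m d) \<ge> int (m 1) - 1"

text \<open>The degree bound \<open>deg P \<le> k - 1\<close>, with \<open>P = 0\<close> for \<open>k = 0\<close>.\<close>

definition degree_below :: "real poly \<Rightarrow> nat \<Rightarrow> bool" where
  "degree_below P k \<longleftrightarrow> P = 0 \<or> degree P < k"

text \<open>The condition \<open>k + 2 \<le> N\<close> expresses \<open>k \<le> N - 2\<close> without truncated subtraction.\<close>

definition type_I_function ::
  "nat \<Rightarrow> nat \<Rightarrow> (nat \<Rightarrow> real) \<Rightarrow> (nat \<Rightarrow> real) \<Rightarrow> (nat \<Rightarrow> nat) \<Rightarrow> (nat \<Rightarrow> nat)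
     \<Rightarrow> (real \<Rightarrow> real) \<Rightarrow> bool" where
  "type_I_function p q a b n m F \<longleftrightarrow>
     (\<exists>A :: nat \<Rightarrow> real poly.
        (\<forall>j\<in>{1..q}. degree_below (A j) (n j)) \<and>
        (\<forall>j\<in>{1..p-q}. degree_below (A (q + j)) (m j)) \<and>
        (\<forall>x>0. F x = (\<Sum>j=1..q. poly (A j) x * w_weight p q a b j x)
                     + (\<Sum>j=1..p-q. poly (A (q + j)) x * v_weight p q a b j x)) \<and>
        (\<forall>k. k + 2 \<le> (\<Sum>j=1..q. n j) + (\<Sum>j=1..p-q. m j) \<longrightarrow>
             (LBINT x:{0<..}. F x * x ^ k) = 0))"

definition has_mellin_transform :: "(real \<Rightarrow> real) \<Rightarrow> complex \<Rightarrow> complex \<Rightarrow> bool" where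
  "has_mellin_transform f s c \<longleftrightarrow>
     set_integrable lborel {0<..} (\<lambda>x. complex_of_real (f x) * complex_of_real x powr (s - 1)) \<and>
     (LBINT x:{0<..}. complex_of_real (f x) * complex_of_real x powr (s - 1)) = c"

end

theory Submission
  imports Defs
begin

text \<open>
  Mellin convolution multiplies Mellin transforms, and \<open>f \<mapsto> -(x f)'\<close> multiplies them by \<open>s - 1\<close>.
  Since multiplication by \<open>x\<^sup>k\<close> shifts \<open>s\<close> by \<open>k\<close>, every summand of \<open>F\<close> has a transform of the form
  \<open>\<Gamma>(s + a) / \<Gamma>(s + b + n)\<close> times a real rational function of \<open>s\<close>. Nearness to the diagonal
  makes that function a polynomial and, together with the step-line condition, bounds its degree
  by \<open>|n| + |m| - 1\<close>. The orthogonality conditions are zeros at \<open>s = 1, \<dots>, |n| + |m| - 1\<close>, which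
  determine the polynomial up to a constant.
\<close>

section \<open>The Mellin transform\<close>

text \<open>The weights \<open>v_weight\<close> are defined with \<open>deriv\<close>, so their
  transforms have the expected form only once \<open>w0\<close> is known to be differentiable often
  enough at every x > 0. Beta weights with b - a < 1 blow up at 1 and cannot supply this. Since q <
  p, at least one factor is a gamma weight, and it stands last in the convolution; all smoothness is
  drawn from it. Mellin integrability alone makes a convolution integral converge only for almost
  every x, hence the pointwise bounds by powers of x that are carried along with the transforms. The
  factor s - 1 is not obtained by integration by parts: it is read off for the gamma weight from
  Gamma(z + 1) = z Gamma(z) and passed through each convolution by differentiating under the
  integral. Finally, the orthogonality conditions become zeros of the polynomial factor because a_j
  > -1 puts s = 1, 2, ... inside the half-plane, where the Gamma quotient is finite and
  nonzero.\<close>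

lemma has_mellin_iff:
  "has_mellin_transform f s c \<longleftrightarrow>
     has_bochner_integral lborel
       (\<lambda>x. complex_of_real (indicator {0<..} x * f x) * complex_of_real x powr (s - 1)) c"
proof -
  have "(\<lambda>x. indicat_real {0<..} x *\<^sub>R (complex_of_real (f x) * complex_of_real x powr (s - 1)))
      = (\<lambda>x. complex_of_real (indicator {0<..} x * f x) * complex_of_real x powr (s - 1))"
    by (auto simp: fun_eq_iff scaleR_conv_of_real)
  thus ?thesis
    by (simp add: has_mellin_transform_def has_bochner_integral_iff set_integrable_def
        set_lebesgue_integral_def)
qed

lemma borel_measurable_powr_pos:
  "(\<lambda>x::real. indicator {0<..} x * complex_of_real x powr s) \<in> borel_measurable borel"
proof -
  have "(\<lambda>x::real. indicator {0<..} x * complex_of_real x powr s) =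
        (\<lambda>x. indicator {0<..} x * exp (s * complex_of_real (ln x)))"
    by (auto simp: fun_eq_iff powr_def Ln_of_real indicator_def)
  also have "\<dots> \<in> borel_measurable borel"
    by measurable
  finally show ?thesis .
qed

text \<open>The transform speaks only of the whole integrand; measurability of \<open>f\<close>
  itself is recovered by multiplying back with x powr (1 - s). Fubini for convolutions needs
  it.\<close>

lemma has_mellin_measurable:
  assumes "has_mellin_transform f s c"
  shows "(\<lambda>x. indicator {0<..} x * f x) \<in> borel_measurable borel"
proof -
  have m: "(\<lambda>x. complex_of_real (indicator {0<..} x * f x) * complex_of_real x powr (s - 1))
          \<in> borel_measurable borel"
    using assms unfolding has_mellin_iff by (auto dest: borel_measurable_has_bochner_integral)
  have "(\<lambda>x. Re ((complex_of_real (indicator {0<..} x * f x) * complex_of_real x powr (s - 1))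
              * (indicator {0<..} x * complex_of_real x powr (1 - s)))) \<in> borel_measurable borel"
    using m borel_measurable_powr_pos by measurable
  also have "(\<lambda>x. Re ((complex_of_real (indicator {0<..} x * f x) * complex_of_real x powr (s - 1))
              * (indicator {0<..} x * complex_of_real x powr (1 - s)))) = (\<lambda>x. indicator {0<..} x * f x)"
  proof
    fix x :: real
    show "Re ((complex_of_real (indicator {0<..} x * f x) * complex_of_real x powr (s - 1))
              * (indicator {0<..} x * complex_of_real x powr (1 - s))) = indicator {0<..} x * f x"
    proof (cases "x > 0")
      case True
      hence "complex_of_real x powr (s - 1) * complex_of_real x powr (1 - s) = 1"
        by (simp add: powr_add [symmetric])
      moreover have "indicator {0<..} x = (1::complex)" "indicator {0<..} x = (1::real)"
        using True by auto
      ultimately show ?thesis by (simp add: mult.assoc del: Re_complex_of_real times_complex.sel) simp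
    qed simp
  qed
  finally show ?thesis .
qed

lemma has_mellin_cong:
  assumes "has_mellin_transform f s c" "\<And>x. x > 0 \<Longrightarrow> g x = f x"
  shows "has_mellin_transform g s c"
proof -
  have "(\<lambda>x. indicator {0<..} x * g x) = (\<lambda>x. indicator {0<..} x * f x)"
    using assms(2) by (auto simp: indicator_def)
  thus ?thesis using assms(1) unfolding has_mellin_iff by metis
qed

text \<open>The modulus of x powr (s - 1) depends only on Re s, so convergence at s gives absolute
  convergence at the real point Re s. This supplies the majorants for Fubini and for dominated
  convergence.\<close>

lemma has_mellin_abs:
  assumes "has_mellin_transform f s c"
  obtains d where "has_mellin_transform (\<lambda>x. \<bar>f x\<bar>) (complex_of_real (Re s)) d"
proof -
  have "integrable lborel (\<lambda>x. complex_of_real (norm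
     (complex_of_real (indicator {0<..} x * f x) * complex_of_real x powr (s - 1))))"
    using assms unfolding has_mellin_iff has_bochner_integral_iff by (intro integrable_of_real integrable_norm) auto
  also have "(\<lambda>x. complex_of_real (norm
     (complex_of_real (indicator {0<..} x * f x) * complex_of_real x powr (s - 1)))) =
     (\<lambda>x. complex_of_real (indicator {0<..} x * \<bar>f x\<bar>) * complex_of_real x powr (complex_of_real (Re s) - 1))"
    (is "?l = ?r")
  proof
    fix x :: real
    show "?l x = ?r x"
    proof (cases "x > 0")
      case True
      have "complex_of_real x powr (complex_of_real (Re s) - 1) = complex_of_real (x powr (Re s - 1))"
        using True by (simp add: powr_of_real [symmetric])
      with True show ?thesis by (simp add: norm_mult norm_powr_real_powr)
    qed simp
  qed
  finally show ?thesis using that unfolding has_mellin_iff has_bochner_integral_iff by blast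
qed

lemma has_mellin_real:
  assumes "has_mellin_transform f (complex_of_real \<sigma>) c"
  shows "has_bochner_integral lborel (\<lambda>x. indicator {0<..} x * f x * x powr (\<sigma> - 1)) (Re c)"
proof -
  have "has_bochner_integral lborel (\<lambda>x. Re (complex_of_real (indicator {0<..} x * f x) * complex_of_real x powr (complex_of_real \<sigma> - 1))) (Re c)"
    using assms unfolding has_mellin_iff by (intro has_bochner_integral_bounded_linear[OF bounded_linear_Re])
  also have "(\<lambda>x. Re (complex_of_real (indicator {0<..} x * f x) * complex_of_real x powr (complex_of_real \<sigma> - 1))) = (\<lambda>x. indicator {0<..} x * f x * x powr (\<sigma> - 1))"
    (is "?l = ?r")
  proof
    fix x :: real
    show "?l x = ?r x"
    proof (cases "x > 0")
      case True
      have "complex_of_real x powr (complex_of_real \<sigma> - 1) = complex_of_real (x powr (\<sigma> - 1))"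
        using True by (simp add: powr_of_real [symmetric])
      with True show ?thesis by simp
    qed simp
  qed
  finally show ?thesis .
qed

lemma has_mellin_scale:
  assumes "has_mellin_transform h s d" "t > 0"
  shows "has_mellin_transform (\<lambda>x. h (x / t)) s (complex_of_real t powr s * d)"
proof -
  let ?F = "\<lambda>x. complex_of_real (indicator {0<..} x * h x) * complex_of_real x powr (s - 1)"
  have "has_bochner_integral lborel (\<lambda>x. ?F (0 + (1/t) * x)) (d /\<^sub>R \<bar>1/t\<bar>)"
    using assms by (subst lborel_has_bochner_integral_real_affine_iff [symmetric]) (auto simp: has_mellin_iff)
  hence "has_bochner_integral lborel (\<lambda>x. complex_of_real t powr (s-1) * ?F (0 + (1/t) * x))
            (complex_of_real t powr (s-1) * (d /\<^sub>R \<bar>1/t\<bar>))"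
    by (intro has_bochner_integral_mult_right) auto
  also have "complex_of_real t powr (s-1) * (d /\<^sub>R \<bar>1/t\<bar>) = complex_of_real t powr s * d"
    using assms(2) by (simp add: powr_diff scaleR_conv_of_real)
  also have "(\<lambda>x. complex_of_real t powr (s-1) * ?F (0 + (1/t) * x)) =
     (\<lambda>x. complex_of_real (indicator {0<..} x * h (x/t)) * complex_of_real x powr (s - 1))" (is "?l = ?r")
  proof
    fix x :: real
    show "?l x = ?r x"
    proof (cases "x > 0")
      case True
      hence "complex_of_real t powr (s-1) * complex_of_real (x / t) powr (s-1) = complex_of_real x powr (s-1)"
        using assms(2) powr_times_real[of "complex_of_real t" "complex_of_real (x / t)" "s - 1"]
        by simp
      with True assms(2) show ?thesis by (simp add: algebra_simps)
    next
      case False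
      thus ?thesis using assms(2) by (simp add: indicator_def zero_less_divide_iff)
    qed
  qed
  finally show ?thesis by (simp add: has_mellin_iff)
qed

text \<open>Fubini for the kernel \<open>K\<close>. For fixed t the integral over x is the transform
  of a dilate of \<open>h\<close>, which yields t powr (s - 1) times \<open>d\<close>. The same
  computation with moduli, at Re s, leaves a multiple of |f t| t powr (Re s - 1), which is
  integrable.\<close>

lemma has_mellin_mellin_conv:
  assumes f: "has_mellin_transform f s c" and h: "has_mellin_transform h s d"
  shows "has_mellin_transform (mellin_conv f h) s (c * d)"
proof -
  define f' where "f' = (\<lambda>x. indicator {0<..} x * f x)"
  define h' where "h' = (\<lambda>x. indicator {0<..} x * h x)"
  have [measurable]: "f' \<in> borel_measurable borel" "h' \<in> borel_measurable borel"
    using has_mellin_measurable[OF f] has_mellin_measurable[OF h] by (simp_all add: f'_def h'_def)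
  define K where "K = (\<lambda>t x. complex_of_real (f' t * h' (x / t) / t) * complex_of_real x powr (s - 1))"
  have Km: "(\<lambda>(t,x). K t x) \<in> borel_measurable (lborel \<Otimes>\<^sub>M lborel)"
  proof -
    have "(\<lambda>(t,x). K t x) = (\<lambda>(t, x). complex_of_real (f' t * h' (x / t) / t) *
        (indicator {0<..} x * complex_of_real x powr (s - 1)))"
      by (auto simp: fun_eq_iff K_def f'_def h'_def indicator_def zero_less_divide_iff)
    also have "\<dots> \<in> borel_measurable (lborel \<Otimes>\<^sub>M lborel)"
      using borel_measurable_powr_pos by measurable
    finally show ?thesis .
  qed
  obtain e where e: "has_mellin_transform (\<lambda>x. \<bar>h x\<bar>) (complex_of_real (Re s)) e"
    using has_mellin_abs[OF h] .
  obtain e' where e': "has_mellin_transform (\<lambda>x. \<bar>f x\<bar>) (complex_of_real (Re s)) e'"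
    using has_mellin_abs[OF f] .
  have inner: "has_bochner_integral lborel (K t) (complex_of_real (f' t) * complex_of_real t powr (s - 1) * d)" for t
  proof (cases "t > 0")
    case True
    from has_mellin_scale[OF h True]
    have "has_bochner_integral lborel (\<lambda>x. complex_of_real (f' t / t) * (complex_of_real (indicator {0<..} x * h (x/t)) * complex_of_real x powr (s - 1)))
       (complex_of_real (f' t / t) * (complex_of_real t powr s * d))"
      unfolding has_mellin_iff by (intro has_bochner_integral_mult_right) auto
    also have "(\<lambda>x. complex_of_real (f' t / t) * (complex_of_real (indicator {0<..} x * h (x/t)) * complex_of_real x powr (s - 1))) = K t"
      using True by (auto simp: K_def h'_def indicator_def zero_less_divide_iff fun_eq_iff)
    also have "(complex_of_real (f' t / t) * (complex_of_real t powr s * d)) = complex_of_real (f' t) * complex_of_real t powr (s - 1) * d"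
      using True by (simp add: powr_diff)
    finally show ?thesis .
  next
    case False
    hence "K t = (\<lambda>x. 0)" by (auto simp: K_def f'_def)
    with False show ?thesis by (simp add: f'_def has_bochner_integral_zero)
  qed
  have norm_inner: "(\<integral>x. norm (K t x) \<partial>lborel) = indicator {0<..} t * \<bar>f t\<bar> * t powr (Re s - 1) * Re e" for t
  proof (cases "t > 0")
    case True
    from has_mellin_real [OF has_mellin_scale[OF e True]]
    have "has_bochner_integral lborel (\<lambda>x. \<bar>f' t\<bar> / t * (indicator {0<..} x * \<bar>h (x / t)\<bar> * x powr (Re s - 1)))
       (\<bar>f' t\<bar> / t * Re (complex_of_real t powr complex_of_real (Re s) * e))"
      by (intro has_bochner_integral_mult_right) auto
    also have "(\<lambda>x. \<bar>f' t\<bar> / t * (indicator {0<..} x * \<bar>h (x / t)\<bar> * x powr (Re s - 1))) = (\<lambda>x. norm (K t x))"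
      using True by (auto simp: K_def h'_def indicator_def zero_less_divide_iff fun_eq_iff norm_mult norm_divide abs_mult norm_powr_real_powr)
    also have "\<bar>f' t\<bar> / t * Re (complex_of_real t powr complex_of_real (Re s) * e) =
       indicator {0<..} t * \<bar>f t\<bar> * t powr (Re s - 1) * Re e"
      using True by (simp add: powr_of_real powr_diff f'_def)
    finally show ?thesis by (simp add: has_bochner_integral_iff)
  next
    case False
    hence "K t = (\<lambda>x. 0)" by (auto simp: K_def f'_def)
    with False show ?thesis by simp
  qed
  have int: "integrable (lborel \<Otimes>\<^sub>M lborel) (\<lambda>(t,x). K t x)"
  proof (rule lborel_pair.Fubini_integrable [OF Km])
    have "integrable lborel (\<lambda>t. indicator {0<..} t * \<bar>f t\<bar> * t powr (Re s - 1))"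
      using has_mellin_real[OF e'] by (simp add: has_bochner_integral_iff)
    hence "integrable lborel (\<lambda>t. (indicator {0<..} t * \<bar>f t\<bar> * t powr (Re s - 1)) * Re e)"
      by (rule integrable_mult_left)
    thus "integrable lborel (\<lambda>t. \<integral>x. norm (case (t, x) of (t, x) \<Rightarrow> K t x) \<partial>lborel)"
      by (simp add: norm_inner)
    show "AE t in lborel. integrable lborel (\<lambda>x. case (t, x) of (t, x) \<Rightarrow> K t x)"
      using inner by (auto simp: has_bochner_integral_iff)
  qed
  \<comment> \<open>This holds at every x, even where the convolution integral diverges: the Bochner
    integral is then 0 on both sides, and a factor free of t can always be pulled out.\<close>
  have outer: "(\<integral>t. K t x \<partial>lborel) = complex_of_real (indicator {0<..} x * mellin_conv f h x) * complex_of_real x powr (s - 1)" for x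
  proof (cases "x > 0")
    case True
    have fe: "(\<lambda>t. f' t * h' (x / t) / t) = (\<lambda>t. indicat_real {0<..} t *\<^sub>R (f t * h (x / t) / t))"
      using True by (auto simp: f'_def h'_def indicator_def fun_eq_iff)
    have "(\<integral>t. K t x \<partial>lborel) = (\<integral>t. complex_of_real (f' t * h' (x / t) / t) \<partial>lborel) * complex_of_real x powr (s - 1)"
      unfolding K_def by (rule integral_mult_left_zero)
    also have "(\<integral>t. complex_of_real (f' t * h' (x / t) / t) \<partial>lborel) = complex_of_real (mellin_conv f h x)"
      unfolding integral_complex_of_real mellin_conv_def set_lebesgue_integral_def fe ..
    finally show ?thesis using True by simp
  next
    case False
    hence "K t x = 0" for t by (auto simp: K_def f'_def h'_def indicator_def zero_less_divide_iff)
    with False show ?thesis by simp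
  qed
  have "has_bochner_integral lborel (\<lambda>t. complex_of_real (f' t) * complex_of_real t powr (s - 1) * d) (c * d)"
    using f unfolding has_mellin_iff f'_def by (intro has_bochner_integral_mult_left) auto
  hence "(\<integral>t. (\<integral>x. K t x \<partial>lborel) \<partial>lborel) = c * d"
    using inner by (simp add: has_bochner_integral_iff)
  moreover have "(\<integral>x. (\<integral>t. K t x \<partial>lborel) \<partial>lborel) = (\<integral>t. (\<integral>x. K t x \<partial>lborel) \<partial>lborel)"
    using int by (rule lborel_pair.Fubini_integral)
  moreover have "integrable lborel (\<lambda>x. (\<integral>t. K t x \<partial>lborel))"
    using lborel_pair.integrable_snd[OF int] by simp
  ultimately show ?thesis by (simp add: has_mellin_iff has_bochner_integral_iff outer)
qed

section \<open>Uniqueness, linearity and multiplication by polynomials\<close>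

lemma has_mellin_unique:
  "has_mellin_transform f s c \<Longrightarrow> has_mellin_transform f s d \<Longrightarrow> c = d"
  by (auto simp: has_mellin_transform_def)

lemma has_mellin_add:
  assumes "has_mellin_transform f s c" "has_mellin_transform g s d"
  shows "has_mellin_transform (\<lambda>x. f x + g x) s (c + d)"
proof -
  have "has_bochner_integral lborel
       (\<lambda>x. complex_of_real (indicator {0<..} x * f x) * complex_of_real x powr (s - 1) +
            complex_of_real (indicator {0<..} x * g x) * complex_of_real x powr (s - 1)) (c + d)"
    using assms unfolding has_mellin_iff by (rule has_bochner_integral_add)
  thus ?thesis unfolding has_mellin_iff by (simp add: algebra_simps)
qed

lemma has_mellin_cmult:
  assumes "has_mellin_transform f s c"
  shows "has_mellin_transform (\<lambda>x. k * f x) s (complex_of_real k * c)"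
proof -
  have "has_bochner_integral lborel
       (\<lambda>x. complex_of_real k * (complex_of_real (indicator {0<..} x * f x) * complex_of_real x powr (s - 1)))
       (complex_of_real k * c)"
    using assms unfolding has_mellin_iff by (intro has_bochner_integral_mult_right)
  thus ?thesis unfolding has_mellin_iff by (simp add: algebra_simps)
qed

lemma has_mellin_power_mult:
  assumes "has_mellin_transform f (s + of_nat k) c"
  shows "has_mellin_transform (\<lambda>x. x ^ k * f x) s c"
proof -
  have "(\<lambda>x. complex_of_real (indicator {0<..} x * f x) * complex_of_real x powr (s + of_nat k - 1)) =
        (\<lambda>x. complex_of_real (indicator {0<..} x * (x ^ k * f x)) * complex_of_real x powr (s - 1))"
  proof
    fix x :: real
    have "complex_of_real x powr (s + of_nat k - 1) = complex_of_real x ^ k * complex_of_real x powr (s - 1)" if "x > 0"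
      using that powr_add[of "complex_of_real x" "s - 1" "of_nat k"] by (simp add: powr_nat' algebra_simps)
    thus "complex_of_real (indicator {0<..} x * f x) * complex_of_real x powr (s + of_nat k - 1) =
      complex_of_real (indicator {0<..} x * (x ^ k * f x)) * complex_of_real x powr (s - 1)"
      by (cases "x > 0") auto
  qed
  with assms show ?thesis unfolding has_mellin_iff by simp
qed

lemma has_mellin_sum:
  assumes "\<And>i. i \<in> I \<Longrightarrow> has_mellin_transform (f i) s (c i)"
  shows "has_mellin_transform (\<lambda>x. \<Sum>i\<in>I. f i x) s (\<Sum>i\<in>I. c i)"
proof -
  have "has_bochner_integral lborel
     (\<lambda>x. \<Sum>i\<in>I. complex_of_real (indicator {0<..} x * f i x) * complex_of_real x powr (s - 1)) (\<Sum>i\<in>I. c i)"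
    using assms unfolding has_mellin_iff by (rule has_bochner_integral_sum)
  thus ?thesis unfolding has_mellin_iff by (simp add: sum_distrib_left sum_distrib_right)
qed

lemma has_mellin_poly:
  assumes "\<And>k. k \<le> degree A \<Longrightarrow> has_mellin_transform f (s + of_nat k) (c k)"
  shows "has_mellin_transform (\<lambda>x. poly A x * f x) s (\<Sum>k\<le>degree A. complex_of_real (coeff A k) * c k)"
proof -
  have "has_mellin_transform (\<lambda>x. \<Sum>k\<le>degree A. coeff A k * (x ^ k * f x)) s
     (\<Sum>k\<le>degree A. complex_of_real (coeff A k) * c k)"
    using assms by (intro has_mellin_sum has_mellin_cmult has_mellin_power_mult) auto
  thus ?thesis by (simp add: poly_altdef sum_distrib_right mult.assoc)
qed

section \<open>Decay and differentiability of Mellin convolutions\<close>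

text \<open>Dominated convergence along an arbitrary null sequence. The mean value inequality turns
  the bound \<open>w\<close> on the derivative into the same bound on the difference
  quotients.\<close>

lemma has_real_derivative_integral:
  fixes f f' :: "real \<Rightarrow> 'a \<Rightarrow> real"
  assumes "r > 0"
    and deriv: "\<And>y t. \<bar>y - x\<bar> < r \<Longrightarrow> ((\<lambda>y. f y t) has_real_derivative f' y t) (at y)"
    and int: "\<And>y. \<bar>y - x\<bar> < r \<Longrightarrow> integrable M (f y)"
    and meas: "f' x \<in> borel_measurable M"
    and bound: "\<And>y t. \<bar>y - x\<bar> < r \<Longrightarrow> \<bar>f' y t\<bar> \<le> w t"
    and w: "integrable M w"
  shows "((\<lambda>y. \<integral>t. f y t \<partial>M) has_real_derivative (\<integral>t. f' x t \<partial>M)) (at x)"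
  unfolding DERIV_def
proof (rule LIMSEQ_SEQ_conv[THEN iffD1], intro allI impI, elim conjE)
  fix S :: "nat \<Rightarrow> real"
  assume S0: "\<forall>n. S n \<noteq> 0" and S: "S \<longlonglongrightarrow> 0"
  have "\<forall>\<^sub>F n in sequentially. \<bar>S n\<bar> < r"
    using order_tendstoD(2)[OF tendsto_rabs_zero[OF S] \<open>r > 0\<close>] .
  then obtain N where N: "\<And>n. n \<ge> N \<Longrightarrow> \<bar>S n\<bar> < r"
    by (auto simp: eventually_sequentially)
  \<comment> \<open>Dropping the first \<open>N\<close> terms keeps all points x + T n in the ball
    where the hypotheses apply.\<close>
  define T where "T = (\<lambda>n. S (n + N))"
  have T: "\<bar>T n\<bar> < r" "T n \<noteq> 0" for n using N S0 by (auto simp: T_def)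
  have Tlim: "T \<longlonglongrightarrow> 0" unfolding T_def using S by (rule LIMSEQ_ignore_initial_segment)
  have "(\<lambda>n. \<integral>t. (f (x + T n) t - f x t) / T n \<partial>M) \<longlonglongrightarrow> (\<integral>t. f' x t \<partial>M)"
  proof (rule integral_dominated_convergence[where w = w])
    show "(\<lambda>t. (f (x + T n) t - f x t) / T n) \<in> borel_measurable M" for n
      using int[of "x + T n"] int[of x] T[of n] \<open>r > 0\<close>
      by (intro borel_measurable_divide borel_measurable_diff borel_measurable_integrable) auto
    show "AE t in M. (\<lambda>n. (f (x + T n) t - f x t) / T n) \<longlonglongrightarrow> f' x t"
    proof (rule AE_I2)
      fix t
      have "(\<lambda>h. (f (x + h) t - f x t) / h) \<midarrow>0\<rightarrow> f' x t"
        using deriv[of x t] \<open>r > 0\<close> by (simp add: DERIV_def)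
      thus "(\<lambda>n. (f (x + T n) t - f x t) / T n) \<longlonglongrightarrow> f' x t"
        using Tlim T(2) unfolding LIMSEQ_SEQ_conv[symmetric] by blast
    qed
    show "AE t in M. norm ((f (x + T n) t - f x t) / T n) \<le> w t" for n
    proof (rule AE_I2)
      fix t
      have d: "((\<lambda>y. f y t) has_field_derivative f' y t) (at y within ball x r)" if "y \<in> ball x r" for y
        by (rule has_field_derivative_at_within[OF deriv]) (use that in \<open>simp add: dist_real_def abs_minus_commute\<close>)
      have b: "norm (f' y t) \<le> w t" if "y \<in> ball x r" for y
        using bound[of y t] that by (simp add: dist_real_def abs_minus_commute)
      have "norm (f (x + T n) t - f x t) \<le> w t * norm (x + T n - x)"
        by (rule field_differentiable_bound[OF convex_ball d b]) (use T[of n] \<open>r > 0\<close> in \<open>simp_all add: dist_real_def\<close>)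
      thus "norm ((f (x + T n) t - f x t) / T n) \<le> w t"
        using T(2)[of n] by (simp add: field_simps)
    qed
  qed (use meas w in auto)
  also have "(\<lambda>n. \<integral>t. (f (x + T n) t - f x t) / T n \<partial>M) =
        (\<lambda>n. ((\<integral>t. f (x + T n) t \<partial>M) - (\<integral>t. f x t \<partial>M)) / T n)"
  proof
    fix n
    show "(\<integral>t. (f (x + T n) t - f x t) / T n \<partial>M) = ((\<integral>t. f (x + T n) t \<partial>M) - (\<integral>t. f x t \<partial>M)) / T n"
      using int[of "x + T n"] int[of x] T[of n] \<open>r > 0\<close> by (simp add: Bochner_Integration.integral_diff)
  qed
  finally show "(\<lambda>n. ((\<integral>t. f (x + S n) t \<partial>M) - (\<integral>t. f x t \<partial>M)) / S n) \<longlonglongrightarrow> (\<integral>t. f' x t \<partial>M)"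
    unfolding T_def by (rule LIMSEQ_offset)
qed

text \<open>The power bound makes convolution integrals converge at each x rather than almost
  everywhere. Having it for every exponent above \<alpha> leaves \<sigma> free to be chosen positive
  when differentiating.\<close>

definition mellin_decay :: "real \<Rightarrow> (real \<Rightarrow> real) \<Rightarrow> (complex \<Rightarrow> complex) \<Rightarrow> bool" where
  "mellin_decay \<alpha> h \<phi> \<longleftrightarrow>
     (\<forall>\<sigma>>\<alpha>. \<exists>C. \<forall>x>0. \<bar>h x\<bar> \<le> C * x powr (-\<sigma>)) \<and>
     (\<forall>s. Re s > \<alpha> \<longrightarrow> has_mellin_transform h s (\<phi> s))"

lemma mellin_decayD:
  assumes "mellin_decay \<alpha> h \<phi>"
  shows "\<And>\<sigma>. \<sigma> > \<alpha> \<Longrightarrow> \<exists>C. \<forall>x>0. \<bar>h x\<bar> \<le> C * x powr (-\<sigma>)"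
    and "\<And>s. Re s > \<alpha> \<Longrightarrow> has_mellin_transform h s (\<phi> s)"
  using assms by (auto simp: mellin_decay_def)

text \<open>Inserting the bound for \<open>h\<close> at x / t separates the variables: the integrand
  is at most x powr (-\<sigma>) times C |f t| t powr (\<sigma> - 1). One majorant \<open>w\<close>
  thus serves for all x at once, both for decay and for differentiation in x.\<close>

lemma mellin_conv_integrand:
  assumes f: "has_mellin_transform f (complex_of_real \<sigma>) c"
    and h: "has_mellin_transform h s d"
    and C: "\<And>x. x > 0 \<Longrightarrow> \<bar>h x\<bar> \<le> C * x powr (-\<sigma>)"
  obtains w where "integrable lborel w" "\<And>t. w t \<ge> 0"
    "\<And>x t. x > 0 \<Longrightarrow> \<bar>indicator {0<..} t * (f t * h (x / t) / t)\<bar> \<le> x powr (-\<sigma>) * w t"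
    "\<And>x. x > 0 \<Longrightarrow> integrable lborel (\<lambda>t. indicator {0<..} t * (f t * h (x / t) / t))"
proof -
  define w where "w = (\<lambda>t. C * (indicator {0<..} t * \<bar>f t\<bar> * t powr (\<sigma> - 1)))"
  have C0: "C \<ge> 0" using C[of 1] by (auto intro: order_trans[OF abs_ge_zero])
  obtain e where "has_mellin_transform (\<lambda>x. \<bar>f x\<bar>) (complex_of_real \<sigma>) e"
    using has_mellin_abs[OF f] by auto
  from has_mellin_real[OF this] have w: "integrable lborel w"
    unfolding w_def by (intro integrable_mult_right) (auto simp: has_bochner_integral_iff)
  have bd: "\<bar>indicator {0<..} t * (f t * h (x / t) / t)\<bar> \<le> x powr (-\<sigma>) * w t" if "x > 0" for x t
  proof (cases "t > 0")
    case True
    have "\<bar>indicator {0<..} t * (f t * h (x / t) / t)\<bar> = \<bar>f t\<bar> / t * \<bar>h (x / t)\<bar>"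
      using True by (simp add: abs_mult)
    also have "\<dots> \<le> \<bar>f t\<bar> / t * (C * (x / t) powr (-\<sigma>))"
      using True that by (intro mult_left_mono C) auto
    also have "\<dots> = x powr (-\<sigma>) * w t"
      using True that by (simp add: w_def powr_divide powr_minus powr_diff field_simps)
    finally show ?thesis .
  qed (simp add: w_def)
  have "integrable lborel (\<lambda>t. indicator {0<..} t * (f t * h (x / t) / t))" if "x > 0" for x
  proof (rule Bochner_Integration.integrable_bound)
    show "integrable lborel (\<lambda>t. x powr (-\<sigma>) * w t)" using w by auto
    have [measurable]: "(\<lambda>x. indicator {0<..} x * f x) \<in> borel_measurable borel"
      "(\<lambda>x. indicator {0<..} x * h x) \<in> borel_measurable borel"
      using has_mellin_measurable[OF f] has_mellin_measurable[OF h] .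
    have "(\<lambda>t. indicator {0<..} t * (f t * h (x / t) / t)) =
        (\<lambda>t. (indicator {0<..} t * f t) * (indicator {0<..} (x / t) * h (x / t)) / t)"
      using that by (auto simp: indicator_def zero_less_divide_iff fun_eq_iff)
    also have "\<dots> \<in> borel_measurable lborel" by measurable
    finally show "(\<lambda>t. indicator {0<..} t * (f t * h (x / t) / t)) \<in> borel_measurable lborel" .
    show "AE t in lborel. norm (indicator {0<..} t * (f t * h (x / t) / t)) \<le> norm (x powr (-\<sigma>) * w t)"
    proof (rule AE_I2)
      fix t
      show "norm (indicator {0<..} t * (f t * h (x / t) / t)) \<le> norm (x powr (-\<sigma>) * w t)"
        unfolding real_norm_def by (rule order_trans[OF bd[OF that] abs_ge_self])
    qed
  qed
  with w bd C0 show ?thesis by (intro that[of w]) (auto simp: w_def)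
qed

lemma mellin_conv_eq: "mellin_conv f h x = (\<integral>t. indicator {0<..} t * (f t * h (x / t) / t) \<partial>lborel)"
  by (simp add: mellin_conv_def set_lebesgue_integral_def)

lemma mellin_decay_mellin_conv:
  assumes f: "\<And>s. Re s > \<alpha> \<Longrightarrow> has_mellin_transform f s (\<psi> s)" and h: "mellin_decay \<alpha> h \<phi>"
  shows "mellin_decay \<alpha> (mellin_conv f h) (\<lambda>s. \<psi> s * \<phi> s)"
  unfolding mellin_decay_def
proof (intro conjI allI impI)
  fix \<sigma> assume \<sigma>: "\<sigma> > \<alpha>"
  from mellin_decayD(1)[OF h \<sigma>] obtain C where C: "\<And>x. x > 0 \<Longrightarrow> \<bar>h x\<bar> \<le> C * x powr (-\<sigma>)" by blast
  have f\<sigma>: "has_mellin_transform f (complex_of_real \<sigma>) (\<psi> (complex_of_real \<sigma>))"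
    and h\<sigma>: "has_mellin_transform h (complex_of_real \<sigma>) (\<phi> (complex_of_real \<sigma>))"
    using f mellin_decayD(2)[OF h] \<sigma> by auto
  obtain w where w: "integrable lborel w"
    and w0: "\<And>t. w t \<ge> 0"
    and bd: "\<And>x t. x > 0 \<Longrightarrow> \<bar>indicator {0<..} t * (f t * h (x / t) / t)\<bar> \<le> x powr (-\<sigma>) * w t"
    and int: "\<And>x. x > 0 \<Longrightarrow> integrable lborel (\<lambda>t. indicator {0<..} t * (f t * h (x / t) / t))"
    using mellin_conv_integrand[OF f\<sigma> h\<sigma> C] by blast
  have "\<bar>mellin_conv f h x\<bar> \<le> (\<integral>t. w t \<partial>lborel) * x powr (-\<sigma>)" if "x > 0" for x
  proof -
    have "norm (\<integral>t. indicator {0<..} t * (f t * h (x / t) / t) \<partial>lborel) \<le> (\<integral>t. x powr (-\<sigma>) * w t \<partial>lborel)"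
      by (rule Bochner_Integration.integral_norm_bound_integral) (use w bd int that in auto)
    thus ?thesis by (simp add: mellin_conv_eq mult.commute)
  qed
  thus "\<exists>C. \<forall>x>0. \<bar>mellin_conv f h x\<bar> \<le> C * x powr (-\<sigma>)" by blast
next
  fix s :: complex assume "Re s > \<alpha>"
  thus "has_mellin_transform (mellin_conv f h) s (\<psi> s * \<phi> s)"
    using f h by (intro has_mellin_mellin_conv) (auto simp: mellin_decay_def)
qed

text \<open>The operator h \<mapsto> -(y h)' commutes with dilations, so applied to h (y / t) under
  the integral it produces g (y / t) with no extra factor in t. The majorant of
  \<open>mellin_conv_integrand\<close> for \<open>g\<close> justifies the interchange.\<close>

lemma mellin_conv_has_derivative:
  assumes f: "\<And>s. Re s > \<alpha> \<Longrightarrow> has_mellin_transform f s (\<psi> s)"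
    and h: "mellin_decay \<alpha> h \<phi>" and g: "mellin_decay \<alpha> g \<phi>'"
    and deriv: "\<And>y. y > 0 \<Longrightarrow> ((\<lambda>y. y * h y) has_real_derivative - g y) (at y)"
    and "x > 0"
  shows "((\<lambda>y. y * mellin_conv f h y) has_real_derivative - mellin_conv f g x) (at x)"
proof -
  \<comment> \<open>A positive exponent makes y powr (-\<sigma>) decreasing, hence at most (x / 2)
    powr (-\<sigma>) on the interval |y - x| < x / 2.\<close>
  define \<sigma> where "\<sigma> = max \<alpha> 0 + 1"
  have \<sigma>: "\<sigma> > \<alpha>" "\<sigma> > 0" by (auto simp: \<sigma>_def)
  from mellin_decayD(1)[OF h \<sigma>(1)] obtain C where C: "\<And>x. x > 0 \<Longrightarrow> \<bar>h x\<bar> \<le> C * x powr (-\<sigma>)" by blast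
  have f\<sigma>: "has_mellin_transform f (complex_of_real \<sigma>) (\<psi> (complex_of_real \<sigma>))"
    and h\<sigma>: "has_mellin_transform h (complex_of_real \<sigma>) (\<phi> (complex_of_real \<sigma>))"
    using f mellin_decayD(2)[OF h] \<sigma> by auto
  obtain w where wh: "integrable lborel w"
    and wh0: "\<And>t. w t \<ge> 0"
    and bdh: "\<And>x t. x > 0 \<Longrightarrow> \<bar>indicator {0<..} t * (f t * h (x / t) / t)\<bar> \<le> x powr (-\<sigma>) * w t"
    and int_h: "\<And>x. x > 0 \<Longrightarrow> integrable lborel (\<lambda>t. indicator {0<..} t * (f t * h (x / t) / t))"
    using mellin_conv_integrand[OF f\<sigma> h\<sigma> C] by blast
  from mellin_decayD(1)[OF g \<sigma>(1)] obtain C' where C': "\<And>x. x > 0 \<Longrightarrow> \<bar>g x\<bar> \<le> C' * x powr (-\<sigma>)" by blast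
  have g\<sigma>: "has_mellin_transform g (complex_of_real \<sigma>) (\<phi>' (complex_of_real \<sigma>))"
    using mellin_decayD(2)[OF g] \<sigma> by auto
  obtain w where w: "integrable lborel w"
    and w0: "\<And>t. w t \<ge> 0"
    and bd: "\<And>x t. x > 0 \<Longrightarrow> \<bar>indicator {0<..} t * (f t * g (x / t) / t)\<bar> \<le> x powr (-\<sigma>) * w t"
    and int: "\<And>x. x > 0 \<Longrightarrow> integrable lborel (\<lambda>t. indicator {0<..} t * (f t * g (x / t) / t))"
    using mellin_conv_integrand[OF f\<sigma> g\<sigma> C'] by blast
  have "((\<lambda>y. \<integral>t. y * (indicator {0<..} t * (f t * h (y / t) / t)) \<partial>lborel) has_real_derivative
          (\<integral>t. - (indicator {0<..} t * (f t * g (x / t) / t)) \<partial>lborel)) (at x)"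
  proof (rule has_real_derivative_integral[where r = "x / 2" and w = "\<lambda>t. (x/2) powr (-\<sigma>) * w t"
        and f' = "\<lambda>x t. - (indicator {0<..} t * (f t * g (x / t) / t))"])
    fix y t :: real assume y: "\<bar>y - x\<bar> < x / 2"
    hence y': "y > x / 2" "y > 0" using \<open>x > 0\<close> unfolding abs_less_iff by auto
    show "integrable lborel (\<lambda>t. y * (indicator {0<..} t * (f t * h (y / t) / t)))"
      using int_h[OF y'(2)] by (rule integrable_mult_right)
    have "\<bar>indicator {0<..} t * (f t * g (y / t) / t)\<bar> \<le> y powr (-\<sigma>) * w t" using bd y' by blast
    also have "\<dots> \<le> (x/2) powr (-\<sigma>) * w t"
      using y' \<open>x > 0\<close> \<sigma> w0 by (intro mult_right_mono powr_mono2') auto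
    finally show "\<bar>- (indicator {0<..} t * (f t * g (y / t) / t))\<bar> \<le> (x/2) powr (-\<sigma>) * w t"
      by simp
    show "((\<lambda>y. y * (indicator {0<..} t * (f t * h (y / t) / t))) has_real_derivative
       - (indicator {0<..} t * (f t * g (y / t) / t))) (at y)"
    proof (cases "t > 0")
      case True
      have "((\<lambda>y. f t * ((\<lambda>y. y * h y) (y / t))) has_real_derivative f t * (- g (y / t) * (1 / t))) (at y)"
        using True y' by (intro DERIV_cmult DERIV_chain2[OF deriv]) (auto intro!: derivative_eq_intros)
      thus ?thesis using True by (simp add: mult_ac)
    qed simp
  qed (use \<open>x > 0\<close> w int in \<open>auto intro: borel_measurable_integrable\<close>)
  thus ?thesis
    unfolding integral_mult_right_zero Bochner_Integration.integral_minus mellin_conv_eq .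
qed

text \<open>
  \<open>\<phi>\<close> is the Mellin transform, and \<open>k\<close> steps of \<open>h \<mapsto> -(x h)'\<close> stay in the class. Under convolution
  all derivatives fall on the right factor, so the left one may be a beta weight with a
  singularity at 1.
\<close>

fun mellin_diff :: "real \<Rightarrow> nat \<Rightarrow> (real \<Rightarrow> real) \<Rightarrow> (complex \<Rightarrow> complex) \<Rightarrow> bool" where
  "mellin_diff \<alpha> 0 h \<phi> \<longleftrightarrow> mellin_decay \<alpha> h \<phi>"
| "mellin_diff \<alpha> (Suc k) h \<phi> \<longleftrightarrow> mellin_decay \<alpha> h \<phi> \<and>
     (\<exists>g. (\<forall>x>0. ((\<lambda>y. y * h y) has_real_derivative - g x) (at x)) \<and>
          mellin_diff \<alpha> k g (\<lambda>s. (s - 1) * \<phi> s))"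

section \<open>Closure of \<open>mellin_diff\<close> under congruence, convolution and
  iteration\<close>

lemma mellin_diff_SucI:
  assumes "mellin_decay \<alpha> h \<phi>"
    and "\<And>x. x > 0 \<Longrightarrow> ((\<lambda>y. y * h y) has_real_derivative - g x) (at x)"
    and "mellin_diff \<alpha> k g (\<lambda>s. (s - 1) * \<phi> s)"
  shows "mellin_diff \<alpha> (Suc k) h \<phi>"
  using assms by auto

lemma mellin_diff_imp_decay: "mellin_diff \<alpha> k h \<phi> \<Longrightarrow> mellin_decay \<alpha> h \<phi>"
  by (cases k) auto

lemma mellin_decay_cong:
  assumes "mellin_decay \<alpha> h \<phi>" "\<And>x. x > 0 \<Longrightarrow> h' x = h x" "\<And>s. Re s > \<alpha> \<Longrightarrow> \<phi>' s = \<phi> s"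
  shows "mellin_decay \<alpha> h' \<phi>'"
  using assms by (auto simp: mellin_decay_def intro: has_mellin_cong)

text \<open>Needed because \<open>deriv\<close> is known to equal the witness \<open>g\<close> only
  on the positive axis, and the functional equation of Gamma is applied only on the half-plane.
  Differentiability transfers since it is local on an open set.\<close>

lemma mellin_diff_cong:
  assumes "mellin_diff \<alpha> k h \<phi>" "\<And>x. x > 0 \<Longrightarrow> h' x = h x" "\<And>s. Re s > \<alpha> \<Longrightarrow> \<phi>' s = \<phi> s"
  shows "mellin_diff \<alpha> k h' \<phi>'"
  using assms
proof (induction k arbitrary: h \<phi> h' \<phi>')
  case 0
  thus ?case by (auto intro: mellin_decay_cong)
next
  case (Suc k)
  from Suc.prems(1) obtain g where g: "mellin_decay \<alpha> h \<phi>"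
    "\<And>x. x > 0 \<Longrightarrow> ((\<lambda>y. y * h y) has_real_derivative - g x) (at x)"
    "mellin_diff \<alpha> k g (\<lambda>s. (s - 1) * \<phi> s)" by auto
  have "((\<lambda>y. y * h' y) has_real_derivative - g x) (at x)" if "x > 0" for x
    using g(2)[OF that] that Suc.prems(2)
    by (rule_tac has_field_derivative_transform_within_open[where S = "{0<..}"]) auto
  moreover have "mellin_diff \<alpha> k g (\<lambda>s. (s - 1) * \<phi>' s)"
    by (rule Suc.IH[OF g(3)]) (auto simp: Suc.prems)
  ultimately show ?case using mellin_decay_cong[OF g(1) Suc.prems(2,3)] by auto
qed

lemma mellin_diff_mellin_conv:
  assumes f: "\<And>s. Re s > \<alpha> \<Longrightarrow> has_mellin_transform f s (\<psi> s)" and "mellin_diff \<alpha> k h \<phi>"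
  shows "mellin_diff \<alpha> k (mellin_conv f h) (\<lambda>s. \<psi> s * \<phi> s)"
  using assms(2)
proof (induction k arbitrary: h \<phi>)
  case 0
  thus ?case using f by (simp add: mellin_decay_mellin_conv)
next
  case (Suc k)
  then obtain g where g: "mellin_decay \<alpha> h \<phi>"
    "\<And>x. x > 0 \<Longrightarrow> ((\<lambda>y. y * h y) has_real_derivative - g x) (at x)"
    "mellin_diff \<alpha> k g (\<lambda>s. (s - 1) * \<phi> s)" by auto
  have "((\<lambda>y. y * mellin_conv f h y) has_real_derivative - mellin_conv f g x) (at x)" if "x > 0" for x
    using f g that by (intro mellin_conv_has_derivative[OF f g(1) mellin_diff_imp_decay[OF g(3)]])
  moreover have "mellin_diff \<alpha> k (mellin_conv f g) (\<lambda>s. (s - 1) * (\<psi> s * \<phi> s))"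
    using Suc.IH[OF g(3)] by (simp add: mult_ac)
  ultimately show ?case using mellin_decay_mellin_conv[OF f g(1)] by auto
qed

lemma mellin_diff_mellin_conv_list:
  assumes "\<And>j s. j \<in> set js \<Longrightarrow> Re s > \<alpha> \<Longrightarrow> has_mellin_transform (f j) s (\<psi> j s)"
    and "mellin_diff \<alpha> k g \<phi>"
  shows "mellin_diff \<alpha> k (mellin_conv_list (map f js @ [g])) (\<lambda>s. (\<Prod>j\<leftarrow>js. \<psi> j s) * \<phi> s)"
  using assms(1)
proof (induction js)
  case Nil
  thus ?case using assms(2) by simp
next
  case (Cons j js)
  \<comment> \<open>The tail contains \<open>g\<close> and so is not empty: the equation of
    \<open>mellin_conv_list\<close> for two or more factors applies.\<close>
  obtain g' gs where gs: "map f js @ [g] = g' # gs"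
    by (cases js) auto
  have "mellin_diff \<alpha> k (mellin_conv (f j) (mellin_conv_list (map f js @ [g])))
      (\<lambda>s. \<psi> j s * ((\<Prod>j\<leftarrow>js. \<psi> j s) * \<phi> s))"
    using Cons by (intro mellin_diff_mellin_conv) auto
  thus ?case by (simp add: gs mult.assoc)
qed

text \<open>Here the total operator \<open>deriv\<close> in \<open>v_weight\<close> meets the
  genuine derivatives stored in \<open>mellin_diff\<close>. The recursion of
  \<open>mellin_diff\<close> consumes the innermost application, so the iterate is unfolded with
  \<open>funpow_Suc_right\<close>.\<close>

lemma mellin_diff_funpow:
  assumes "mellin_diff \<alpha> k h \<phi>"
  shows "mellin_decay \<alpha> (((\<lambda>f x. - deriv (\<lambda>y. y * f y) x) ^^ k) h) (\<lambda>s. (s - 1) ^ k * \<phi> s)"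
  using assms
proof (induction k arbitrary: h \<phi>)
  case (Suc k)
  then obtain g where g:
    "\<And>x. x > 0 \<Longrightarrow> ((\<lambda>y. y * h y) has_real_derivative - g x) (at x)"
    "mellin_diff \<alpha> k g (\<lambda>s. (s - 1) * \<phi> s)" by auto
  have "mellin_diff \<alpha> k (\<lambda>x. - deriv (\<lambda>y. y * h y) x) (\<lambda>s. (s - 1) * \<phi> s)"
    by (rule mellin_diff_cong[OF g(2)]) (use DERIV_imp_deriv[OF g(1)] in auto)
  from Suc.IH[OF this] show ?case
    by (simp only: funpow_Suc_right o_apply power_Suc2 mult.assoc)
qed auto

section \<open>Transforms of the weights\<close>

lemma has_mellin_gamma_weight:
  assumes "Re s > - a"
  shows "has_mellin_transform (gamma_weight a) s (Gamma (s + complex_of_real a))"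
proof -
  let ?z = "s + complex_of_real a"
  let ?F = "\<lambda>t. complex_of_real t powr (?z - 1) / complex_of_real (exp t)"
  have z: "Re ?z > 0" using assms by simp
  have eq: "(\<lambda>x. indicat_real {0<..} x *\<^sub>R ?F x) =
     (\<lambda>x. complex_of_real (indicator {0<..} x * gamma_weight a x) * complex_of_real x powr (s - 1))"
  proof
    fix x :: real
    have "complex_of_real x powr (?z - 1) = complex_of_real (x powr a) * complex_of_real x powr (s - 1)" if "x > 0"
      using that powr_add[of "complex_of_real x" "s - 1" "of_real a"] by (simp add: powr_of_real algebra_simps)
    thus "indicat_real {0<..} x *\<^sub>R ?F x =
     complex_of_real (indicator {0<..} x * gamma_weight a x) * complex_of_real x powr (s - 1)"
      by (cases "x > 0") (auto simp: gamma_weight_def exp_minus field_simps)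
  qed
  have "(\<lambda>x. indicat_real {0<..} x *\<^sub>R ?F x) =
    (\<lambda>x. (indicator {0<..} x * complex_of_real x powr (?z - 1)) / complex_of_real (exp x))"
    by (auto simp: fun_eq_iff indicator_def)
  also have "\<dots> \<in> borel_measurable borel" using borel_measurable_powr_pos[of "?z - 1"] by measurable
  finally have m: "(\<lambda>x. indicat_real {0<..} x *\<^sub>R ?F x) \<in> borel_measurable borel" .
  \<comment> \<open>The Gamma integral is stated over \<open>lebesgue\<close>; the Borel
    measurability \<open>m\<close> identifies it with the integral over
    \<open>lborel\<close>.\<close>
  have i: "set_integrable lebesgue {0<..} ?F"
    using absolutely_integrable_Gamma_integral'[OF z] .
  hence i': "integrable lborel (\<lambda>x. indicat_real {0<..} x *\<^sub>R ?F x)"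
    unfolding set_integrable_def using m by (simp add: integrable_completion)
  have "(\<integral>x. indicat_real {0<..} x *\<^sub>R ?F x \<partial>lborel) = (LINT x:{0<..}|lebesgue. ?F x)"
    unfolding set_lebesgue_integral_def using m by (simp add: integral_completion)
  also have "\<dots> = integral {0<..} ?F"
    using set_lebesgue_integral_eq_integral(2)[OF i] .
  also have "\<dots> = Gamma ?z" using Gamma_integral_complex'[OF z] by (rule integral_unique)
  finally show ?thesis
    unfolding has_mellin_iff has_bochner_integral_iff eq [symmetric] using i' by simp
qed

text \<open>Raise x / \<beta> \<le> exp (x / \<beta>) to the power \<beta>. With \<beta> = a +
  \<sigma> this is the decay of the gamma weight.\<close>

lemma powr_times_exp_minus_bounded:
  fixes x \<beta> :: real assumes "\<beta> > 0" "x > 0"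
  shows "x powr \<beta> * exp (- x) \<le> \<beta> powr \<beta>"
proof -
  have "x / \<beta> \<le> exp (x / \<beta>)" using exp_ge_add_one_self[of "x / \<beta>"] by linarith
  hence "(x / \<beta>) powr \<beta> \<le> exp (x / \<beta>) powr \<beta>" using assms by (intro powr_mono2) auto
  also have "\<dots> = exp x" using assms by (simp add: powr_def)
  finally show ?thesis using assms by (simp add: powr_divide exp_minus field_simps)
qed

lemma mellin_decay_gamma_weight:
  assumes "\<alpha> \<ge> - a"
  shows "mellin_decay \<alpha> (gamma_weight a) (\<lambda>s. Gamma (s + complex_of_real a))"
  unfolding mellin_decay_def
proof (intro conjI allI impI)
  fix \<sigma> assume "\<sigma> > \<alpha>"
  hence "\<bar>gamma_weight a x\<bar> \<le> (a + \<sigma>) powr (a + \<sigma>) * x powr (-\<sigma>)" if "x > 0" for x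
    using powr_times_exp_minus_bounded[of "a + \<sigma>" x] assms that
    by (simp add: gamma_weight_def powr_add powr_minus field_simps)
  thus "\<exists>C. \<forall>x>0. \<bar>gamma_weight a x\<bar> \<le> C * x powr (-\<sigma>)" by blast
qed (use assms in \<open>auto intro!: has_mellin_gamma_weight\<close>)

section \<open>Linear combinations in the decay and differentiability classes\<close>

lemma mellin_decay_add:
  assumes "mellin_decay \<alpha> f \<phi>" "mellin_decay \<alpha> g \<psi>"
  shows "mellin_decay \<alpha> (\<lambda>x. f x + g x) (\<lambda>s. \<phi> s + \<psi> s)"
  unfolding mellin_decay_def
proof (intro conjI allI impI)
  fix \<sigma> assume "\<sigma> > \<alpha>"
  then obtain C D where "\<forall>x>0. \<bar>f x\<bar> \<le> C * x powr (-\<sigma>)" "\<forall>x>0. \<bar>g x\<bar> \<le> D * x powr (-\<sigma>)"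
    using mellin_decayD(1)[OF assms(1)] mellin_decayD(1)[OF assms(2)] by metis
  hence "\<forall>x>0. \<bar>f x + g x\<bar> \<le> (C + D) * x powr (-\<sigma>)"
    unfolding distrib_right by (meson abs_triangle_ineq add_mono order_trans)
  thus "\<exists>C. \<forall>x>0. \<bar>f x + g x\<bar> \<le> C * x powr (-\<sigma>)" by blast
qed (use assms in \<open>auto simp: mellin_decay_def intro!: has_mellin_add\<close>)

lemma mellin_decay_cmult:
  assumes "mellin_decay \<alpha> f \<phi>"
  shows "mellin_decay \<alpha> (\<lambda>x. k * f x) (\<lambda>s. complex_of_real k * \<phi> s)"
  unfolding mellin_decay_def
proof (intro conjI allI impI)
  fix \<sigma> assume "\<sigma> > \<alpha>"
  then obtain C where "\<forall>x>0. \<bar>f x\<bar> \<le> C * x powr (-\<sigma>)"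
    using mellin_decayD(1)[OF assms(1)] by metis
  hence "\<forall>x>0. \<bar>k * f x\<bar> \<le> (\<bar>k\<bar> * C) * x powr (-\<sigma>)"
    by (simp add: abs_mult mult_left_mono mult.assoc)
  thus "\<exists>C. \<forall>x>0. \<bar>k * f x\<bar> \<le> C * x powr (-\<sigma>)" by blast
qed (use assms in \<open>auto simp: mellin_decay_def intro!: has_mellin_cmult\<close>)

lemma mellin_diff_add:
  assumes "mellin_diff \<alpha> k f \<phi>" "mellin_diff \<alpha> k g \<psi>"
  shows "mellin_diff \<alpha> k (\<lambda>x. f x + g x) (\<lambda>s. \<phi> s + \<psi> s)"
  using assms
proof (induction k arbitrary: f g \<phi> \<psi>)
  case 0
  thus ?case by (simp add: mellin_decay_add)
next
  case (Suc k)
  then obtain f' g' where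
    f': "\<And>x. x > 0 \<Longrightarrow> ((\<lambda>y. y * f y) has_real_derivative - f' x) (at x)"
      "mellin_diff \<alpha> k f' (\<lambda>s. (s - 1) * \<phi> s)" and
    g': "\<And>x. x > 0 \<Longrightarrow> ((\<lambda>y. y * g y) has_real_derivative - g' x) (at x)"
      "mellin_diff \<alpha> k g' (\<lambda>s. (s - 1) * \<psi> s)" by auto
  have "((\<lambda>y. y * (f y + g y)) has_real_derivative - (f' x + g' x)) (at x)" if "x > 0" for x
    using DERIV_add[OF f'(1)[OF that] g'(1)[OF that]] by (simp add: algebra_simps)
  moreover have "mellin_diff \<alpha> k (\<lambda>x. f' x + g' x) (\<lambda>s. (s - 1) * (\<phi> s + \<psi> s))"
    using Suc.IH[OF f'(2) g'(2)] by (simp add: algebra_simps)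
  ultimately show ?case using Suc.prems
    by (intro mellin_diff_SucI[where g = "\<lambda>x. f' x + g' x"] mellin_decay_add) auto
qed

lemma mellin_diff_cmult:
  assumes "mellin_diff \<alpha> k f \<phi>"
  shows "mellin_diff \<alpha> k (\<lambda>x. c * f x) (\<lambda>s. complex_of_real c * \<phi> s)"
  using assms
proof (induction k arbitrary: f \<phi>)
  case 0
  thus ?case by (simp add: mellin_decay_cmult)
next
  case (Suc k)
  then obtain f' where
    f': "\<And>x. x > 0 \<Longrightarrow> ((\<lambda>y. y * f y) has_real_derivative - f' x) (at x)"
      "mellin_diff \<alpha> k f' (\<lambda>s. (s - 1) * \<phi> s)" by auto
  have "((\<lambda>y. y * (c * f y)) has_real_derivative - (c * f' x)) (at x)" if "x > 0" for x
    using DERIV_cmult[OF f'(1)[OF that], of c] by (simp add: algebra_simps)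
  moreover have "mellin_diff \<alpha> k (\<lambda>x. c * f' x) (\<lambda>s. (s - 1) * (complex_of_real c * \<phi> s))"
    using Suc.IH[OF f'(2)] by (simp add: algebra_simps)
  ultimately show ?case using Suc.prems
    by (intro mellin_diff_SucI[where g = "\<lambda>x. c * f' x"] mellin_decay_cmult) auto
qed

text \<open>Differentiation stays among gamma weights: the function \<open>g\<close> below combines
  those with parameters a + 1 and a. The induction therefore runs over all a at once, and raising a
  preserves the hypothesis on \<alpha>. The transform of \<open>g\<close> is Gamma(z + 1) - (a + 1)
  Gamma(z) with z = s + a, which is (s - 1) Gamma(z).\<close>

lemma mellin_diff_gamma_weight:
  assumes "\<alpha> \<ge> - a"
  shows "mellin_diff \<alpha> k (gamma_weight a) (\<lambda>s. Gamma (s + complex_of_real a))"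
  using assms
proof (induction k arbitrary: a)
  case 0
  thus ?case by (simp add: mellin_decay_gamma_weight)
next
  case (Suc k)
  define g where "g = (\<lambda>x. gamma_weight (a + 1) x + (- (a + 1)) * gamma_weight a x)"
  have "((\<lambda>y. y * gamma_weight a y) has_real_derivative - g x) (at x)" if "x > 0" for x
  proof -
    have "((\<lambda>y. exp (- y)) has_real_derivative - exp (- x)) (at x)"
      by (auto intro!: derivative_eq_intros)
    from DERIV_mult[OF has_real_derivative_powr[OF that, of "a + 1"] this]
    have "((\<lambda>y. y powr (a + 1) * exp (- y)) has_real_derivative - g x) (at x)"
      using that by (simp add: g_def gamma_weight_def algebra_simps)
    thus ?thesis
      by (rule has_field_derivative_transform_within_open[where S = "{0<..}"])
        (use that in \<open>auto simp: gamma_weight_def powr_add\<close>)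
  qed
  moreover have "mellin_diff \<alpha> k g (\<lambda>s. (s - 1) * Gamma (s + complex_of_real a))"
  proof (rule mellin_diff_cong)
    show "mellin_diff \<alpha> k g (\<lambda>s. Gamma (s + complex_of_real (a + 1)) +
        complex_of_real (- (a + 1)) * Gamma (s + complex_of_real a))"
      unfolding g_def using Suc.prems by (intro mellin_diff_add mellin_diff_cmult Suc.IH) auto
    fix s :: complex assume "Re s > \<alpha>"
    hence "s + complex_of_real a \<notin> \<int>\<^sub>\<le>\<^sub>0" using Suc.prems
      by (auto elim!: nonpos_Ints_cases simp: complex_eq_iff)
    hence "Gamma (s + complex_of_real a + 1) = (s + complex_of_real a) * Gamma (s + complex_of_real a)"
      by (rule Gamma_plus1)
    thus "(s - 1) * Gamma (s + complex_of_real a) = Gamma (s + complex_of_real (a + 1)) +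
        complex_of_real (- (a + 1)) * Gamma (s + complex_of_real a)"
      by (simp add: algebra_simps)
  qed simp
  ultimately show ?case using mellin_decay_gamma_weight[OF Suc.prems] by auto
qed

text \<open>
  The next identity gives the transform of the beta weight at complex \<open>s\<close> from the Gamma
  integral alone. It is the substitution \<open>u = x (1 - t) / t\<close>.
\<close>

lemma mellin_conv_beta_gamma_weight:
  assumes "a < b" "x > 0"
  shows "mellin_conv (beta_weight a b) (gamma_weight b) x = gamma_weight a x"
proof -
  define c where "c = b - a"
  have c: "c > 0" using assms by (simp add: c_def)
  define f where "f = (\<lambda>u. u powr (c - 1) / exp u)"
  define g where "g = (\<lambda>t. x * (1 - t) / t)"
  \<comment> \<open>The Gamma integrand pulled back along \<open>g\<close>; the modulus is there
    because \<open>g\<close> is decreasing.\<close>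
  define F where "F = (\<lambda>t. \<bar>- x / t\<^sup>2\<bar> * f (g t))"
  have img: "g ` {0<..<1} = {0<..}"
  proof (intro equalityI subsetI)
    fix u :: real assume u: "u \<in> {0<..}"
    \<comment> \<open>Solving u = x (1 - t) / t for t gives the preimage x / (x + u).\<close>
    have "1 - x / (x + u) = u / (x + u)" using u assms by (simp add: field_simps)
    hence "u = g (x / (x + u))" using u assms by (simp add: g_def)
    moreover have "x / (x + u) \<in> {0<..<1}" using u assms by (simp add: field_simps)
    ultimately show "u \<in> g ` {0<..<1}" by blast
  qed (use assms in \<open>auto simp: g_def\<close>)
  have inj: "inj_on g {0<..<1}"
    using assms by (auto simp: inj_on_def g_def field_simps)
  have der: "(g has_field_derivative (- x / t\<^sup>2)) (at t within {0<..<1})" if "t \<in> {0<..<1}" for t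
    unfolding g_def using that
    by (auto intro!: derivative_eq_intros simp: field_simps power2_eq_square)
  have "(f has_integral Gamma c) {0..}"
    unfolding f_def by (rule Gamma_integral_real[OF c])
  hence "(f has_integral Gamma c) {0<..}"
    by (subst has_integral_spike_set_eq[of _ "{0..}"]) (auto intro: negligible_subset[of "{0}"])
  hence abs: "f absolutely_integrable_on {0<..}" and int: "integral {0<..} f = Gamma c"
    by (auto intro!: nonnegative_absolutely_integrable_1 integral_unique has_integral_integrable simp: f_def)
  have F: "F absolutely_integrable_on {0<..<1}" "integral {0<..<1} F = Gamma c"
    using has_absolute_integral_change_of_variables_1'[OF _ der inj, of f "Gamma c"] abs int img
    by (simp_all add: F_def)
  have eq: "indicat_real {0<..} t *\<^sub>R (beta_weight a b t * gamma_weight b (x / t) / t) =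
      (gamma_weight a x / Gamma c) * (indicat_real {0<..<1} t *\<^sub>R F t)" for t
  proof (cases "0 < t \<and> t < 1")
    case True
    hence t: "t > 0" "1 - t > 0" by auto
    \<comment> \<open>Since x / t = x + g t, the exponential splits into the one of the target
      \<open>gamma_weight a x\<close> and the one of the Gamma integrand.\<close>
    have "exp (- (x / t)) = exp (- x) * exp (- (x * (1 - t) / t))"
      using t by (simp add: exp_add [symmetric] field_simps)
    moreover have "(x * (1 - t) / t) powr (c - 1) = x powr (c - 1) * (1 - t) powr (c - 1) / t powr (c - 1)"
      using t assms by (simp only: powr_mult powr_divide)
    moreover have "y powr (c - 1) = y powr b / (y powr a * y)" if "y > 0" for y :: real
      using that by (simp add: c_def powr_diff)
    note this[OF t(1)] this[OF \<open>x > 0\<close>]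
    moreover have "b - a - 1 = c - 1" by (simp add: c_def)
    ultimately show ?thesis using t True assms
      by (simp add: beta_weight_def gamma_weight_def F_def f_def g_def c_def [symmetric] exp_minus
          powr_divide power2_eq_square)
        (simp add: field_simps)
  qed (auto simp: beta_weight_def)
  have m: "(\<lambda>t. indicat_real {0<..<1} t *\<^sub>R F t) \<in> borel_measurable borel"
    unfolding F_def f_def g_def by measurable
  have "mellin_conv (beta_weight a b) (gamma_weight b) x =
     (gamma_weight a x / Gamma c) * (\<integral>t. indicat_real {0<..<1} t *\<^sub>R F t \<partial>lborel)"
    unfolding mellin_conv_def set_lebesgue_integral_def eq by (rule integral_mult_right_zero)
  also have "(\<integral>t. indicat_real {0<..<1} t *\<^sub>R F t \<partial>lborel) = (LINT t:{0<..<1}|lebesgue. F t)"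
    unfolding set_lebesgue_integral_def using m by (simp add: integral_completion)
  also have "\<dots> = Gamma c" using set_lebesgue_integral_eq_integral(2)[OF F(1)] F(2) by simp
  also have "gamma_weight a x / Gamma c * Gamma c = gamma_weight a x"
    using Gamma_real_pos[OF c] by simp
  finally show ?thesis .
qed

text \<open>Convergence comes from domination by a real Beta integrand, so some transform c exists.
  Convolution with \<open>gamma_weight b\<close> turns c into c Gamma(s + b), and the preceding
  identity forces this to be Gamma(s + a). Dividing by Gamma(s + b), which is not 0, gives
  c.\<close>

lemma has_mellin_beta_weight:
  assumes "a < b" "Re s > - a"
  shows "has_mellin_transform (beta_weight a b) s (Gamma (s + complex_of_real a) / Gamma (s + complex_of_real b))"
proof -
  let ?F = "\<lambda>x. complex_of_real (indicator {0<..} x * beta_weight a b x) * complex_of_real x powr (s - 1)"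
  define w where "w = (\<lambda>t. indicat_real {0..1} t *\<^sub>R (t powr (a + Re s - 1) * (1 - t) powr (b - a - 1)))"
  have w: "integrable lborel w"
    using integrable_Beta[of "a + Re s" "b - a"] assms by (simp add: set_integrable_def w_def)
  have "integrable lborel ?F"
  proof (rule Bochner_Integration.integrable_bound)
    show "integrable lborel (\<lambda>t. w t / Gamma (b - a))" using w by simp
    have "?F = (\<lambda>x. complex_of_real (beta_weight a b x) * (indicator {0<..} x * complex_of_real x powr (s - 1)))"
      by (auto simp: fun_eq_iff indicator_def)
    also have "\<dots> \<in> borel_measurable lborel"
      using borel_measurable_powr_pos[of "s - 1"] unfolding beta_weight_def by measurable
    finally show "?F \<in> borel_measurable lborel" .
    have "norm (?F x) \<le> norm (w x / Gamma (b - a))" for x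
    proof (cases "0 < x \<and> x < 1")
      case True
      hence "x powr (a + Re s - 1) = x powr a * x powr (Re s - 1)"
        by (simp add: powr_add [symmetric] add_diff_eq)
      moreover have "norm (?F x) = \<bar>beta_weight a b x\<bar> * x powr (Re s - 1)"
        using True by (simp add: norm_mult norm_powr_real_powr)
      ultimately show ?thesis
        using True by (simp add: w_def beta_weight_def abs_mult mult_ac)
    qed (auto simp: beta_weight_def)
    thus "AE x in lborel. norm (?F x) \<le> norm (w x / Gamma (b - a))" by simp
  qed
  then obtain c where c: "has_mellin_transform (beta_weight a b) s c"
    unfolding has_mellin_iff using has_bochner_integral_integrable by blast
  have "has_mellin_transform (mellin_conv (beta_weight a b) (gamma_weight b)) s (c * Gamma (s + complex_of_real b))"
    using assms by (intro has_mellin_mellin_conv[OF c] has_mellin_gamma_weight) simp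
  hence "has_mellin_transform (gamma_weight a) s (c * Gamma (s + complex_of_real b))"
    by (rule has_mellin_cong) (simp add: mellin_conv_beta_gamma_weight[OF assms(1)])
  from has_mellin_unique[OF this has_mellin_gamma_weight[OF assms(2)]]
  have "c * Gamma (s + complex_of_real b) = Gamma (s + complex_of_real a)" .
  moreover have "s + complex_of_real b \<notin> \<int>\<^sub>\<le>\<^sub>0" using assms
    by (auto elim!: nonpos_Ints_cases simp: complex_eq_iff)
  hence "Gamma (s + complex_of_real b) \<noteq> 0" by (simp add: Gamma_eq_zero_iff)
  ultimately have "c = Gamma (s + complex_of_real a) / Gamma (s + complex_of_real b)"
    by (simp add: field_simps)
  with c show ?thesis by simp
qed

text \<open>Kept for arbitrary \<open>b\<close>: the transforms of \<open>w_weight\<close>, the base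
  of those of \<open>v_weight\<close>, and the common factor with b + n are all instances, to be
  compared by shifting parameters.\<close>

definition w0_transform :: "nat \<Rightarrow> nat \<Rightarrow> (nat \<Rightarrow> real) \<Rightarrow> (nat \<Rightarrow> real) \<Rightarrow> complex \<Rightarrow> complex" where
  "w0_transform p q a b s =
     (\<Prod>j=1..p. Gamma (s + complex_of_real (a j))) / (\<Prod>j=1..q. Gamma (s + complex_of_real (b j)))"

lemma mellin_diff_w0:
  assumes "q < p" "\<And>j. j \<in> {1..q} \<Longrightarrow> a j < b j"
  shows "mellin_diff (- Min (a ` {1..p})) k (w0 p q a b) (w0_transform p q a b)"
proof -
  define \<alpha> where "\<alpha> = - Min (a ` {1..p})"
  have \<alpha>: "- a j \<le> \<alpha>" if "j \<in> {1..p}" for j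
    using that by (auto simp: \<alpha>_def intro: Min_le)
  define f where "f = (\<lambda>j. if j \<le> q then beta_weight (a j) (b j) else gamma_weight (a j))"
  define \<psi> where "\<psi> = (\<lambda>j s. if j \<le> q then Gamma (s + complex_of_real (a j)) / Gamma (s + complex_of_real (b j))
                            else Gamma (s + complex_of_real (a j)))"
  have "[1..<p] = [1..<q+1] @ [q+1..<p]"
    using \<open>q < p\<close> by (metis Suc_eq_plus1 Suc_leI add_leD2 le_add1 le_add_diff_inverse plus_1_eq_Suc upt_add_eq_append)
  moreover have "[q+1..<p+1] = [q+1..<p] @ [p]" using \<open>q < p\<close> by simp
  \<comment> \<open>Because p > q, the factor with index p is a gamma weight. It is split off as the
    innermost function, on which all derivatives act.\<close>
  ultimately have "w0 p q a b = mellin_conv_list (map f [1..<p] @ [gamma_weight (a p)])"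
    unfolding w0_def by (auto simp: f_def intro!: arg_cong[where f = mellin_conv_list])
  moreover have "mellin_diff \<alpha> k (mellin_conv_list (map f [1..<p] @ [gamma_weight (a p)]))
     (\<lambda>s. (\<Prod>j\<leftarrow>[1..<p]. \<psi> j s) * Gamma (s + complex_of_real (a p)))"
  proof (intro mellin_diff_mellin_conv_list mellin_diff_gamma_weight)
    show "- a p \<le> \<alpha>" using \<alpha> \<open>q < p\<close> by auto
    fix j and s :: complex assume "j \<in> set [1..<p]" "\<alpha> < Re s"
    with \<alpha>[of j] assms(2)[of j] show "has_mellin_transform (f j) s (\<psi> j s)"
      by (auto simp: f_def \<psi>_def intro!: has_mellin_beta_weight has_mellin_gamma_weight)
  qed
  moreover have "(\<Prod>j\<leftarrow>[1..<p]. \<psi> j s) * Gamma (s + complex_of_real (a p)) = w0_transform p q a b s" for s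
  proof -
    have "(\<Prod>j\<leftarrow>[1..<p]. \<psi> j s) * Gamma (s + complex_of_real (a p)) = (\<Prod>j\<in>{1..p}. \<psi> j s)"
    proof -
      have "{1..p} = insert p {1..<p}" using \<open>q < p\<close> by auto
      thus ?thesis using \<open>q < p\<close> by (simp add: prod.distinct_set_conv_list [symmetric] \<psi>_def mult.commute)
    qed
    also have "\<dots> = (\<Prod>j\<in>{1..p}. Gamma (s + complex_of_real (a j)) *
                   (if j \<in> {1..q} then inverse (Gamma (s + complex_of_real (b j))) else 1))"
      by (intro prod.cong) (auto simp: \<psi>_def field_simps)
    also have "\<dots> = (\<Prod>j\<in>{1..p}. Gamma (s + complex_of_real (a j))) *
                   (\<Prod>j\<in>{1..p} \<inter> {1..q}. inverse (Gamma (s + complex_of_real (b j))))"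
      by (simp only: prod.distrib prod.inter_restrict finite_atLeastAtMost)
    also have "{1..p} \<inter> {1..q} = {1..q}" using \<open>q < p\<close> by auto
    finally show ?thesis by (simp add: w0_transform_def divide_inverse prod_inversef [symmetric] o_def)
  qed
  ultimately show ?thesis unfolding \<alpha>_def by simp
qed

lemma mellin_decay_v_weight:
  assumes "q < p" "\<And>j. j \<in> {1..q} \<Longrightarrow> a j < b j"
  shows "mellin_decay (- Min (a ` {1..p})) (v_weight p q a b j) (\<lambda>s. (s - 1) ^ (j - 1) * w0_transform p q a b s)"
  unfolding v_weight_def by (intro mellin_diff_funpow mellin_diff_w0 assms)

lemma mellin_decay_w_weight:
  assumes "q < p" "\<And>j. j \<in> {1..q} \<Longrightarrow> a j < b j"
  shows "mellin_decay (- Min (a ` {1..p})) (w_weight p q a b j) (w0_transform p q a (b(j := b j + 1)))"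
proof -
  have "mellin_diff (- Min (a ` {1..p})) 0 (w0 p q a (b(j := b j + 1))) (w0_transform p q a (b(j := b j + 1)))"
  proof (rule mellin_diff_w0[OF assms(1)])
    fix i assume "i \<in> {1..q}"
    from assms(2)[OF this] show "a i < (b(j := b j + 1)) i" by auto
  qed
  thus ?thesis by (simp add: w_weight_def)
qed

section \<open>Real polynomial functions\<close>

text \<open>Reality of the coefficients is recorded so that the final constant is real. A bound in
  place of the exact degree keeps zero summands and sums with cancellation in the class.\<close>

definition real_poly_fun :: "nat \<Rightarrow> (complex \<Rightarrow> complex) \<Rightarrow> bool" where
  "real_poly_fun d f \<longleftrightarrow> (\<exists>P. degree P \<le> d \<and> (\<forall>i. coeff P i \<in> \<real>) \<and> (\<forall>s. f s = poly P s))"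

lemma real_poly_fun_mono: "real_poly_fun d f \<Longrightarrow> d \<le> e \<Longrightarrow> real_poly_fun e f"
  unfolding real_poly_fun_def by (meson order_trans)

lemma real_poly_fun_const [intro]: "real_poly_fun d (\<lambda>_. complex_of_real c)"
  unfolding real_poly_fun_def
  by (rule exI[of _ "[:complex_of_real c:]"]) (auto simp: coeff_pCons split: nat.splits)

lemma real_poly_fun_linear: "real_poly_fun 1 (\<lambda>s. s + complex_of_real c)"
  unfolding real_poly_fun_def
  by (rule exI[of _ "[:complex_of_real c, 1:]"]) (auto simp: coeff_pCons split: nat.splits)

lemma real_poly_fun_add:
  assumes "real_poly_fun d f" "real_poly_fun d g"
  shows "real_poly_fun d (\<lambda>s. f s + g s)"
proof -
  obtain P Q where "degree P \<le> d" "\<forall>i. coeff P i \<in> \<real>" "\<forall>s. f s = poly P s"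
    "degree Q \<le> d" "\<forall>i. coeff Q i \<in> \<real>" "\<forall>s. g s = poly Q s"
    using assms unfolding real_poly_fun_def by blast
  thus ?thesis unfolding real_poly_fun_def
    by (intro exI[of _ "P + Q"]) (auto intro: degree_add_le)
qed

lemma real_poly_fun_mult:
  assumes "real_poly_fun d f" "real_poly_fun e g"
  shows "real_poly_fun (d + e) (\<lambda>s. f s * g s)"
proof -
  obtain P Q where "degree P \<le> d" "\<forall>i. coeff P i \<in> \<real>" "\<forall>s. f s = poly P s"
    "degree Q \<le> e" "\<forall>i. coeff Q i \<in> \<real>" "\<forall>s. g s = poly Q s"
    using assms unfolding real_poly_fun_def by blast
  thus ?thesis unfolding real_poly_fun_def
    by (intro exI[of _ "P * Q"])
      (auto simp: coeff_mult intro!: sum_in_Reals Reals_mult order_trans[OF degree_mult_le] add_mono)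
qed

lemma real_poly_fun_sum:
  "(\<And>i. i \<in> I \<Longrightarrow> real_poly_fun d (f i)) \<Longrightarrow> real_poly_fun d (\<lambda>s. \<Sum>i\<in>I. f i s)"
proof (induction I rule: infinite_finite_induct)
  case (insert i I)
  thus ?case by (auto intro: real_poly_fun_add)
qed (use real_poly_fun_const[of d 0] in auto)

lemma real_poly_fun_prod:
  assumes "finite I" "\<And>i. i \<in> I \<Longrightarrow> real_poly_fun (d i) (f i)"
  shows "real_poly_fun (\<Sum>i\<in>I. d i) (\<lambda>s. \<Prod>i\<in>I. f i s)"
  using assms
proof (induction I rule: finite_induct)
  case (insert i I)
  thus ?case by (auto intro: real_poly_fun_mult)
qed (use real_poly_fun_const[of 0 1] in auto)

lemma real_poly_fun_power:
  "real_poly_fun d f \<Longrightarrow> real_poly_fun (d * k) (\<lambda>s. f s ^ k)"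
  using real_poly_fun_prod[of "{..<k}" "\<lambda>_. d" "\<lambda>_. f"] by (simp add: mult.commute)

lemma real_poly_fun_pochhammer: "real_poly_fun k (\<lambda>s. pochhammer (s + complex_of_real c) k)"
proof -
  have "real_poly_fun 1 (\<lambda>s. s + complex_of_real c + of_nat i)" for i
    using real_poly_fun_linear[of "c + real i"] by (simp add: add.assoc)
  from real_poly_fun_prod[of "{0..<k}" "\<lambda>_. 1", OF _ this] show ?thesis
    by (simp add: pochhammer_prod)
qed

text \<open>Subtracting a suitable multiple of the monic polynomial with zeros 1, ..., d brings the
  degree below d while keeping d zeros, so nothing remains.\<close>

lemma real_poly_fun_zeros:
  assumes f: "real_poly_fun d f" and zero: "\<And>k. k < d \<Longrightarrow> f (of_nat k + 1) = 0"
  shows "\<exists>C::real. \<forall>s. f s = complex_of_real C * pochhammer (1 - s) d"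
proof -
  obtain P where P: "degree P \<le> d" "\<And>i. coeff P i \<in> \<real>" "\<And>s. f s = poly P s"
    using f unfolding real_poly_fun_def by blast
  define Z where "Z = (\<Prod>k<d. [:- (of_nat k + 1), 1:] :: complex poly)"
  have "degree Z = d"
    unfolding Z_def by (subst degree_prod_eq_sum_degree) auto
  moreover have "lead_coeff Z = 1"
    unfolding Z_def by (subst lead_coeff_prod) simp
  ultimately have Z: "degree Z = d" "coeff Z d = 1" by auto
  \<comment> \<open>The coefficient at d, instead of the leading one, also covers degree P < d,
    where P turns out to be 0.\<close>
  define Q where "Q = P - smult (coeff P d) Z"
  have "Q = 0"
  proof (rule ccontr)
    assume "Q \<noteq> 0"
    have "degree Q \<le> d" unfolding Q_def using P(1) Z(1) by (intro degree_diff_le) auto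
    moreover have "coeff Q d = 0" using Z by (simp add: Q_def)
    ultimately have dQ: "degree Q < d"
      using \<open>Q \<noteq> 0\<close> by (metis le_neq_implies_less leading_coeff_0_iff)
    have "(\<lambda>k. of_nat k + 1) ` {..<d} \<subseteq> {x. poly Q x = 0}"
      using zero P(3) by (auto simp: Q_def Z_def poly_prod)
    hence "card ((\<lambda>k. of_nat k + 1 :: complex) ` {..<d}) \<le> card {x. poly Q x = 0}"
      using \<open>Q \<noteq> 0\<close> by (intro card_mono poly_roots_finite)
    also have "\<dots> \<le> degree Q" using \<open>Q \<noteq> 0\<close> by (rule card_poly_roots_bound)
    also have "card ((\<lambda>k. of_nat k + 1 :: complex) ` {..<d}) = d"
      by (subst card_image) (auto simp: inj_on_def)
    finally show False using dQ by simp
  qed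
  hence "P = smult (coeff P d) Z" by (simp add: Q_def)
  hence "poly P s = coeff P d * poly Z s" for s by (metis poly_smult)
  hence "f s = coeff P d * (\<Prod>k<d. s - (of_nat k + 1))" for s
    using P(3)[of s] by (simp add: Z_def poly_prod algebra_simps)
  \<comment> \<open>The factors of the Pochhammer symbol are (k + 1) - s; the resulting sign is
    absorbed into the real constant.\<close>
  moreover have "pochhammer (1 - s) d = (- 1) ^ d * (\<Prod>k<d. s - (of_nat k + 1))" for s :: complex
  proof -
    have "pochhammer (1 - s) d = (\<Prod>k<d. - 1 * (s - (of_nat k + 1)))"
      by (simp add: pochhammer_prod atLeast0LessThan algebra_simps)
    also have "\<dots> = (- 1) ^ d * (\<Prod>k<d. s - (of_nat k + 1))"
      by (subst prod.distrib) simp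
    finally show ?thesis .
  qed
  moreover obtain c where "coeff P d = complex_of_real c" using P(2) by (auto elim: Reals_cases)
  ultimately have "f s = complex_of_real ((- 1) ^ d * c) * pochhammer (1 - s) d" for s
    by (simp add: power_mult_distrib [symmetric])
  thus ?thesis by blast
qed

section \<open>Quotients of shifted transforms and their degrees\<close>

lemma Gamma_add_of_nat:
  assumes "Re z > 0"
  shows "Gamma (z + of_nat n) = Gamma z * pochhammer z n" "Gamma z \<noteq> 0"
proof -
  have z: "z \<notin> \<int>\<^sub>\<le>\<^sub>0" using assms by (auto elim!: nonpos_Ints_cases)
  thus "Gamma z \<noteq> 0" by (simp add: Gamma_eq_zero_iff)
  thus "Gamma (z + of_nat n) = Gamma z * pochhammer z n"
    using pochhammer_Gamma[OF z, of n] by (simp add: field_simps)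
qed

text \<open>Numerators are lowered from s + k to s and denominators raised to the common parameter
  \<open>c\<close>, both by Gamma(z + r) = Gamma(z) (z)_r. The gap \<open>e i\<close> from b i + k
  up to c i has to be a natural number: a negative gap would leave its factors in the
  denominator.\<close>

lemma w0_transform_shift:
  assumes a: "\<And>i. i \<in> {1..p} \<Longrightarrow> Re s > - a i"
    and b: "\<And>i. i \<in> {1..q} \<Longrightarrow> Re s > - b i"
    and e: "\<And>i. i \<in> {1..q} \<Longrightarrow> b i + real k + real (e i) = c i"
  shows "w0_transform p q a b (s + of_nat k) = w0_transform p q a c s *
     ((\<Prod>i=1..p. pochhammer (s + complex_of_real (a i)) k) *
      (\<Prod>i=1..q. pochhammer (s + complex_of_real (b i + real k)) (e i)))"
proof -
  have A: "(\<Prod>i=1..p. Gamma (s + of_nat k + complex_of_real (a i))) =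
     (\<Prod>i=1..p. Gamma (s + complex_of_real (a i))) * (\<Prod>i=1..p. pochhammer (s + complex_of_real (a i)) k)"
    unfolding prod.distrib [symmetric]
  proof (rule prod.cong)
    fix i assume "i \<in> {1..p}"
    with Gamma_add_of_nat(1)[of "s + complex_of_real (a i)" k] a[of i]
    show "Gamma (s + of_nat k + complex_of_real (a i)) =
        Gamma (s + complex_of_real (a i)) * pochhammer (s + complex_of_real (a i)) k"
      by (simp add: add_ac)
  qed simp
  have B: "(\<Prod>i=1..q. Gamma (s + complex_of_real (c i))) = (\<Prod>i=1..q. Gamma (s + of_nat k + complex_of_real (b i))) *
     (\<Prod>i=1..q. pochhammer (s + complex_of_real (b i + real k)) (e i))"
    unfolding prod.distrib [symmetric]
  proof (rule prod.cong)
    fix i assume i: "i \<in> {1..q}"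
    have "s + complex_of_real (c i) = s + complex_of_real (b i + real k) + of_nat (e i)"
      unfolding e[OF i, symmetric] by simp
    with Gamma_add_of_nat(1)[of "s + complex_of_real (b i + real k)" "e i"] b[OF i]
    show "Gamma (s + complex_of_real (c i)) = Gamma (s + of_nat k + complex_of_real (b i)) *
        pochhammer (s + complex_of_real (b i + real k)) (e i)"
      by (simp add: add_ac)
  qed simp
  have "Gamma (s + complex_of_real (c i)) \<noteq> 0" if "i \<in> {1..q}" for i
    using b[OF that] e[OF that] by (intro Gamma_add_of_nat(2)) auto
  hence nz: "(\<Prod>i=1..q. Gamma (s + complex_of_real (c i))) \<noteq> 0" by simp
  show ?thesis using nz unfolding w0_transform_def A B by (simp add: field_simps)
qed

lemma real_poly_fun_shift:
  fixes p q :: nat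
  assumes "(\<Sum>i=1..q. e i) + p * k \<le> d"
  shows "real_poly_fun d (\<lambda>s. (\<Prod>i=1..p. pochhammer (s + complex_of_real (a i)) k) *
      (\<Prod>i=1..q. pochhammer (s + complex_of_real (b i + real k)) (e i)))"
proof -
  have "real_poly_fun ((\<Sum>i=1..p. k) + (\<Sum>i=1..q. e i)) (\<lambda>s. (\<Prod>i=1..p. pochhammer (s + complex_of_real (a i)) k) *
      (\<Prod>i=1..q. pochhammer (s + complex_of_real (b i + real k)) (e i)))"
    by (intro real_poly_fun_mult real_poly_fun_prod real_poly_fun_pochhammer) auto
  thus ?thesis by (rule real_poly_fun_mono) (use assms in simp)
qed

section \<open>Degree counts from nearness to the diagonal and the step-line condition\<close>

lemma near_diagonal_join_index:
  assumes "near_diagonal p (join_index q n m)" "q \<le> p"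
  shows "\<And>i j. i \<in> {1..q} \<Longrightarrow> j \<in> {1..q} \<Longrightarrow> n i \<le> n j + 1"
    and "\<And>i j. i \<in> {1..q} \<Longrightarrow> j \<in> {1..p - q} \<Longrightarrow> n i \<le> m j + 1"
    and "\<And>i j. i \<in> {1..q} \<Longrightarrow> j \<in> {1..p - q} \<Longrightarrow> m j \<le> n i + 1"
    and "\<And>i j. i \<in> {1..p - q} \<Longrightarrow> j \<in> {1..p - q} \<Longrightarrow> m i \<le> m j + 1"
proof -
  have nd: "join_index q n m i \<le> join_index q n m j + 1" if "i \<in> {1..p}" "j \<in> {1..p}" for i j
    using assms(1) that unfolding near_diagonal_def by force
  have N: "i \<in> {1..p}" "join_index q n m i = n i" if "i \<in> {1..q}" for i
    using that \<open>q \<le> p\<close> by (auto simp: join_index_def)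
  have M: "j + q \<in> {1..p}" "join_index q n m (j + q) = m j" if "j \<in> {1..p - q}" for j
    using that \<open>q \<le> p\<close> by (auto simp: join_index_def)
  fix i j
  show "i \<in> {1..q} \<Longrightarrow> j \<in> {1..q} \<Longrightarrow> n i \<le> n j + 1"
    using nd[of i j] N[of i] N[of j] by auto
  show "i \<in> {1..q} \<Longrightarrow> j \<in> {1..p - q} \<Longrightarrow> n i \<le> m j + 1"
    using nd[of i "j + q"] N[of i] M[of j] by auto
  show "i \<in> {1..q} \<Longrightarrow> j \<in> {1..p - q} \<Longrightarrow> m j \<le> n i + 1"
    using nd[of "j + q" i] N[of i] M[of j] by auto
  show "i \<in> {1..p - q} \<Longrightarrow> j \<in> {1..p - q} \<Longrightarrow> m i \<le> m j + 1"
    using nd[of "i + q" "j + q"] M[of i] M[of j] by auto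
qed

lemma on_step_line_antimono:
  assumes "on_step_line d m" "1 \<le> i" "i \<le> j" "j \<le> d"
  shows "m j \<le> m i"
  using assms(3,4)
proof (induction j rule: dec_induct)
  case (step j)
  have "m (j + 1) \<le> m j" using assms(1,2) step unfolding on_step_line_def by auto
  with step show ?case by simp
qed simp

text \<open>By the first claim no subtraction is truncated; for i different from j it reads n_i
  \<ge> n_j - 1 \<ge> k. The degree to be bounded is then |n| + (p - q) k - 1, and k \<le> n_j - 1
  \<le> m_i for every i gives (p - q) k \<le> |m|.\<close>

lemma w_degree_bound:
  assumes "q < p" and nd: "near_diagonal p (join_index q n m)"
    and j: "j \<in> {1..q}" and k: "k < n j"
  shows "i \<in> {1..q} \<Longrightarrow> k + (if i = j then 1 else 0) \<le> n i"
    and "(\<Sum>i=1..q. n i - k - (if i = j then 1 else 0)) + p * k \<le> (\<Sum>i=1..q. n i) + (\<Sum>i=1..p-q. m i) - 1"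
proof -
  note d = near_diagonal_join_index[OF nd less_imp_le[OF \<open>q < p\<close>]]
  have le: "k + (if i = j then 1 else 0) \<le> n i" if "i \<in> {1..q}" for i
    using d(1)[of j i] that j k by auto
  thus "i \<in> {1..q} \<Longrightarrow> k + (if i = j then 1 else 0) \<le> n i" .
  have "(\<Sum>i=1..q. n i) = (\<Sum>i=1..q. (n i - k - (if i = j then 1 else 0)) + k + (if i = j then 1 else 0))"
    using le by (intro sum.cong refl) fastforce
  also have "\<dots> = (\<Sum>i=1..q. n i - k - (if i = j then 1 else 0)) + q * k + 1"
    using j by (simp add: sum.distrib)
  finally have n: "(\<Sum>i=1..q. n i) = (\<Sum>i=1..q. n i - k - (if i = j then 1 else 0)) + q * k + 1" .
  have "(\<Sum>i=1..p-q. k) \<le> (\<Sum>i=1..p-q. m i)"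
    using d(2)[of j] j k by (intro sum_mono) fastforce
  hence "(p - q) * k \<le> (\<Sum>i=1..p-q. m i)" by simp
  moreover have "p * k = q * k + (p - q) * k"
    using \<open>q < p\<close> by (simp add: add_mult_distrib [symmetric])
  ultimately show "(\<Sum>i=1..q. n i - k - (if i = j then 1 else 0)) + p * k \<le> (\<Sum>i=1..q. n i) + (\<Sum>i=1..p-q. m i) - 1"
    using n by linarith
qed

text \<open>The summand j - 1 is the degree of the factor (s - 1) ^ (j - 1) in the transform of
  \<open>v_weight\<close>. What is needed is (p - q) k + j \<le> |m|. The first j entries of m are
  at least m_j \<ge> k + 1 by the step-line condition, the others at least m_j - 1 \<ge> k by
  nearness to the diagonal.\<close>

lemma v_degree_bound:
  assumes "q < p" and nd: "near_diagonal p (join_index q n m)" and sl: "on_step_line (p - q) m"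
    and j: "j \<in> {1..p - q}" and k: "k < m j"
  shows "i \<in> {1..q} \<Longrightarrow> k \<le> n i"
    and "(j - 1) + ((\<Sum>i=1..q. n i - k) + p * k) \<le> (\<Sum>i=1..q. n i) + (\<Sum>i=1..p-q. m i) - 1"
proof -
  note d = near_diagonal_join_index[OF nd less_imp_le[OF \<open>q < p\<close>]]
  have le: "k \<le> n i" if "i \<in> {1..q}" for i
    using d(3)[of i j] that j k by auto
  thus "i \<in> {1..q} \<Longrightarrow> k \<le> n i" .
  have "(\<Sum>i=1..q. n i) = (\<Sum>i=1..q. (n i - k) + k)"
    using le by (intro sum.cong refl) fastforce
  also have "\<dots> = (\<Sum>i=1..q. n i - k) + q * k"
    by (simp add: sum.distrib)
  finally have n: "(\<Sum>i=1..q. n i) = (\<Sum>i=1..q. n i - k) + q * k" .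
  have "(\<Sum>i=1..p-q. k + (if i \<in> {1..j} then 1 else 0)) \<le> (\<Sum>i=1..p-q. m i)"
  proof (rule sum_mono)
    fix i assume "i \<in> {1..p - q}"
    thus "k + (if i \<in> {1..j} then 1 else 0) \<le> m i"
      using d(4)[of j i] on_step_line_antimono[OF sl, of i j] j k by auto
  qed
  also have "(\<Sum>i=1..p-q. k + (if i \<in> {1..j} then 1 else 0)) = (p - q) * k + card ({1..p - q} \<inter> {1..j})"
    by (simp only: sum.distrib sum.inter_restrict [symmetric] finite_atLeastAtMost) simp
  also have "{1..p - q} \<inter> {1..j} = {1..j}" using j by auto
  finally have "(p - q) * k + j \<le> (\<Sum>i=1..p-q. m i)" by simp
  moreover have "p * k = q * k + (p - q) * k"
    using \<open>q < p\<close> by (simp add: add_mult_distrib [symmetric])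
  moreover have "j \<ge> 1" using j by simp
  ultimately show "(j - 1) + ((\<Sum>i=1..q. n i - k) + p * k) \<le> (\<Sum>i=1..q. n i) + (\<Sum>i=1..p-q. m i) - 1"
    using n by linarith
qed

section \<open>The summands over a common Gamma quotient, and the zeros from orthogonality\<close>

theorem theorem3p6:
  fixes p q :: nat and a b :: "nat \<Rightarrow> real" and n m :: "nat \<Rightarrow> nat" and F :: "real \<Rightarrow> real"
  assumes "q < p"
    and "\<forall>j\<in>{1..p}. -1 < a j"
    and "\<forall>j\<in>{1..q}. -1 < b j"
    and "\<forall>j\<in>{1..q}. a j < b j"
    and "near_diagonal p (join_index q n m)"
    and "on_step_line (p - q) m"
    and "(\<Sum>j=1..q. n j) + (\<Sum>j=1..p-q. m j) \<ge> 1"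
    and "type_I_function p q a b n m F"
  shows "\<exists>C::real. \<forall>s::complex. Re s > - Min (a ` {1..p}) \<longrightarrow>
    has_mellin_transform F s
      (complex_of_real C
       * ((\<Prod>j=1..p. Gamma (s + complex_of_real (a j)))
          / (\<Prod>j=1..q. Gamma (s + complex_of_real (b j) + of_nat (n j))))
       * pochhammer (1 - s) ((\<Sum>j=1..q. n j) + (\<Sum>j=1..p-q. m j) - 1))"
proof -
  define N where "N = (\<Sum>j=1..q. n j) + (\<Sum>j=1..p-q. m j)"
  define \<alpha> where "\<alpha> = - Min (a ` {1..p})"
  define c where "c = (\<lambda>j. b j + real (n j))"
  define G where "G = w0_transform p q a c"
  obtain A where
    A: "\<And>j. j \<in> {1..q} \<Longrightarrow> degree_below (A j) (n j)"
       "\<And>j. j \<in> {1..p-q} \<Longrightarrow> degree_below (A (q + j)) (m j)" and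
    F: "\<And>x. x > 0 \<Longrightarrow> F x = (\<Sum>j=1..q. poly (A j) x * w_weight p q a b j x)
                     + (\<Sum>j=1..p-q. poly (A (q + j)) x * v_weight p q a b j x)" and
    orth: "\<And>k. k + 2 \<le> N \<Longrightarrow> (LBINT x:{0<..}. F x * x ^ k) = 0"
    using assms(8) unfolding type_I_function_def N_def by blast
  have ab: "\<And>j. j \<in> {1..q} \<Longrightarrow> a j < b j" using assms(4) by blast
  have a_gt: "Re s > - a i" if "Re s > \<alpha>" "i \<in> {1..p}" for s i
  proof -
    have "- a i \<le> \<alpha>" using that(2) by (auto simp: \<alpha>_def intro: Min_le)
    thus ?thesis using that(1) by simp
  qed
  have b_gt: "Re s > - b i" if "Re s > \<alpha>" "i \<in> {1..q}" for s i
    using a_gt[OF that(1), of i] ab[OF that(2)] that(2) \<open>q < p\<close> by auto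

  have dw: "mellin_decay \<alpha> (w_weight p q a b j) (w0_transform p q a (b(j := b j + 1)))" for j
    unfolding \<alpha>_def using ab by (rule mellin_decay_w_weight[OF \<open>q < p\<close>])
  have dv: "mellin_decay \<alpha> (v_weight p q a b j) (\<lambda>s. (s - 1) ^ (j - 1) * w0_transform p q a b s)" for j
    unfolding \<alpha>_def using ab by (rule mellin_decay_v_weight[OF \<open>q < p\<close>])
  have term_w: "\<exists>f. real_poly_fun (N - 1) f \<and>
      (\<forall>s. Re s > \<alpha> \<longrightarrow> has_mellin_transform (\<lambda>x. poly (A j) x * w_weight p q a b j x) s (G s * f s))"
    if j: "j \<in> {1..q}" for j
  proof (cases "A j = 0")
    \<comment> \<open>The zero polynomial has degree 0 and is allowed for n_j = 0, where the bound k
      < n_j used below would fail already at k = 0.\<close>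
    case True
    thus ?thesis using real_poly_fun_const[of "N - 1" 0]
      by (intro exI[of _ "\<lambda>_. 0"]) (simp add: has_mellin_iff has_bochner_integral_zero)
  next
    case False
    define b' where "b' = b(j := b j + 1)"
    \<comment> \<open>The gap from b' i + k up to b i + n i; the extra 1 at i = j is the increment
      of b in \<open>w_weight\<close>.\<close>
    define e where "e = (\<lambda>k i. n i - k - (if i = j then 1 else 0))"
    define R where "R = (\<lambda>k s. (\<Prod>i=1..p. pochhammer (s + complex_of_real (a i)) k) *
      (\<Prod>i=1..q. pochhammer (s + complex_of_real (b' i + real k)) (e k i)))"
    have k: "k < n j" if "k \<le> degree (A j)" for k
      using A(1)[OF j] False that by (auto simp: degree_below_def)
    define f where "f = (\<lambda>s. \<Sum>k\<le>degree (A j). complex_of_real (coeff (A j) k) * R k s)"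
    \<comment> \<open>The 0 is the degree of the constant coefficients of \<open>A j\<close>, in the
      form that \<open>real_poly_fun_mult\<close> produces.\<close>
    have "real_poly_fun (0 + (N - 1)) f"
      unfolding f_def R_def e_def N_def
      using w_degree_bound(2)[OF \<open>q < p\<close> assms(5) j] k
      by (intro real_poly_fun_sum real_poly_fun_mult real_poly_fun_const real_poly_fun_shift) auto
    moreover have "has_mellin_transform (\<lambda>x. poly (A j) x * w_weight p q a b j x) s (G s * f s)"
      if s: "Re s > \<alpha>" for s
    proof -
      have "w0_transform p q a b' (s + of_nat k) = G s * R k s" if "k \<le> degree (A j)" for k
        unfolding G_def R_def
      proof (rule w0_transform_shift)
        fix i assume i: "i \<in> {1..q}"
        show "- b' i < Re s" using b_gt[OF s i] by (auto simp: b'_def)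
        show "b' i + real k + real (e k i) = c i"
          using w_degree_bound(1)[OF \<open>q < p\<close> assms(5) j k[OF that] i] by (auto simp: b'_def e_def c_def of_nat_diff)
      qed (use a_gt s in auto)
      moreover have "has_mellin_transform (w_weight p q a b j) (s + of_nat k) (w0_transform p q a b' (s + of_nat k))" for k
        using mellin_decayD(2)[OF dw, of "s + of_nat k" j] s
        by (simp add: b'_def)
      ultimately have "has_mellin_transform (\<lambda>x. poly (A j) x * w_weight p q a b j x) s
          (\<Sum>k\<le>degree (A j). complex_of_real (coeff (A j) k) * (G s * R k s))"
        by (intro has_mellin_poly) metis
      thus ?thesis by (simp add: f_def sum_distrib_left mult_ac)
    qed
    ultimately show ?thesis by auto
  qed

  have term_v: "\<exists>f. real_poly_fun (N - 1) f \<and>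
      (\<forall>s. Re s > \<alpha> \<longrightarrow> has_mellin_transform (\<lambda>x. poly (A (q + j)) x * v_weight p q a b j x) s (G s * f s))"
    if j: "j \<in> {1..p-q}" for j
  proof (cases "A (q + j) = 0")
    case True
    thus ?thesis using real_poly_fun_const[of "N - 1" 0]
      by (intro exI[of _ "\<lambda>_. 0"]) (simp add: has_mellin_iff has_bochner_integral_zero)
  next
    case False
    define e where "e = (\<lambda>k i. n i - k)"
    \<comment> \<open>The first factor is (s - 1) ^ (j - 1) evaluated at s + k, written with a real
      shift so that \<open>real_poly_fun_linear\<close> applies.\<close>
    define R where "R = (\<lambda>k s. (s + complex_of_real (real k - 1)) ^ (j - 1) *
      ((\<Prod>i=1..p. pochhammer (s + complex_of_real (a i)) k) *
       (\<Prod>i=1..q. pochhammer (s + complex_of_real (b i + real k)) (e k i))))"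
    have k: "k < m j" if "k \<le> degree (A (q + j))" for k
      using A(2)[OF j] False that by (auto simp: degree_below_def)
    have R: "real_poly_fun (N - 1) (R k)" if "k \<le> degree (A (q + j))" for k
    proof (rule real_poly_fun_mono)
      show "real_poly_fun (1 * (j - 1) + ((\<Sum>i=1..q. e k i) + p * k)) (R k)"
        unfolding R_def
        by (intro real_poly_fun_mult real_poly_fun_power real_poly_fun_linear real_poly_fun_shift) auto
      show "1 * (j - 1) + ((\<Sum>i=1..q. e k i) + p * k) \<le> N - 1"
        using v_degree_bound(2)[OF \<open>q < p\<close> assms(5,6) j k[OF that]] by (simp add: e_def N_def)
    qed
    define f where "f = (\<lambda>s. \<Sum>k\<le>degree (A (q + j)). complex_of_real (coeff (A (q + j)) k) * R k s)"
    have "real_poly_fun (0 + (N - 1)) f"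
      unfolding f_def by (intro real_poly_fun_sum real_poly_fun_mult real_poly_fun_const R) auto
    moreover have "has_mellin_transform (\<lambda>x. poly (A (q + j)) x * v_weight p q a b j x) s (G s * f s)"
      if s: "Re s > \<alpha>" for s
    proof -
      have "(s + of_nat k - 1) ^ (j - 1) * w0_transform p q a b (s + of_nat k) = G s * R k s"
        if "k \<le> degree (A (q + j))" for k
      proof -
        have "w0_transform p q a b (s + of_nat k) = G s *
          ((\<Prod>i=1..p. pochhammer (s + complex_of_real (a i)) k) *
           (\<Prod>i=1..q. pochhammer (s + complex_of_real (b i + real k)) (e k i)))"
          unfolding G_def
        proof (rule w0_transform_shift)
          fix i assume i: "i \<in> {1..q}"
          show "- b i < Re s" using b_gt[OF s i] .
          show "b i + real k + real (e k i) = c i"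
            using v_degree_bound(1)[OF \<open>q < p\<close> assms(5,6) j k[OF that] i] by (simp add: e_def c_def of_nat_diff)
        qed (use a_gt s in auto)
        thus ?thesis by (simp add: R_def add_diff_eq)
      qed
      moreover have "has_mellin_transform (v_weight p q a b j) (s + of_nat k)
          ((s + of_nat k - 1) ^ (j - 1) * w0_transform p q a b (s + of_nat k))" for k
        using mellin_decayD(2)[OF dv, of "s + of_nat k" j] s
        by simp
      ultimately have "has_mellin_transform (\<lambda>x. poly (A (q + j)) x * v_weight p q a b j x) s
          (\<Sum>k\<le>degree (A (q + j)). complex_of_real (coeff (A (q + j)) k) * (G s * R k s))"
        by (intro has_mellin_poly) metis
      thus ?thesis by (simp add: f_def sum_distrib_left mult_ac)
    qed
    ultimately show ?thesis by auto
  qed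

  from term_w obtain fw where fw: "\<And>j. j \<in> {1..q} \<Longrightarrow> real_poly_fun (N - 1) (fw j)"
      "\<And>j s. j \<in> {1..q} \<Longrightarrow> Re s > \<alpha> \<Longrightarrow>
         has_mellin_transform (\<lambda>x. poly (A j) x * w_weight p q a b j x) s (G s * fw j s)"
    by metis
  from term_v obtain fv where fv: "\<And>j. j \<in> {1..p-q} \<Longrightarrow> real_poly_fun (N - 1) (fv j)"
      "\<And>j s. j \<in> {1..p-q} \<Longrightarrow> Re s > \<alpha> \<Longrightarrow>
         has_mellin_transform (\<lambda>x. poly (A (q + j)) x * v_weight p q a b j x) s (G s * fv j s)"
    by metis
  define f where "f = (\<lambda>s. (\<Sum>j=1..q. fw j s) + (\<Sum>j=1..p-q. fv j s))"
  have f: "real_poly_fun (N - 1) f"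
    unfolding f_def using fw fv by (intro real_poly_fun_add real_poly_fun_sum) auto
  have mellin: "has_mellin_transform F s (G s * f s)" if s: "Re s > \<alpha>" for s
  proof (rule has_mellin_cong[OF _ F])
    have "has_mellin_transform (\<lambda>x. (\<Sum>j=1..q. poly (A j) x * w_weight p q a b j x)
                     + (\<Sum>j=1..p-q. poly (A (q + j)) x * v_weight p q a b j x)) s
        ((\<Sum>j=1..q. G s * fw j s) + (\<Sum>j=1..p-q. G s * fv j s))"
      using fw fv s by (intro has_mellin_add has_mellin_sum) auto
    thus "has_mellin_transform (\<lambda>x. (\<Sum>j=1..q. poly (A j) x * w_weight p q a b j x)
                     + (\<Sum>j=1..p-q. poly (A (q + j)) x * v_weight p q a b j x)) s (G s * f s)"
      by (simp add: f_def sum_distrib_left distrib_left)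
  qed
  \<comment> \<open>The range k < N - 1 is exactly k + 2 \<le> N, that of the orthogonality
    conditions. The point is s = k + 1, so that x powr (s - 1) becomes the monomial of degree
    k.\<close>
  have "f (of_nat k + 1) = 0" if k: "k < N - 1" for k
  proof -
    define s :: complex where "s = of_nat k + 1"
    have "Min (a ` {1..p}) \<in> a ` {1..p}" using \<open>q < p\<close> by (intro Min_in) auto
    \<comment> \<open>Re s \<ge> 1, while every a_j exceeds -1.\<close>
    hence s: "Re s > \<alpha>" using assms(2) by (auto simp: \<alpha>_def s_def)
    have "(LBINT x:{0<..}. complex_of_real (F x) * complex_of_real x powr (s - 1)) =
          (LBINT x:{0<..}. complex_of_real (F x * x ^ k))"
      by (intro set_lebesgue_integral_cong) (auto simp: s_def powr_nat')
    also have "\<dots> = complex_of_real (LBINT x:{0<..}. F x * x ^ k)"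
      by (rule set_integral_complex_of_real)
    also have "(LBINT x:{0<..}. F x * x ^ k) = 0" using k by (intro orth) simp
    finally have "G s * f s = 0" using mellin[OF s] by (simp add: has_mellin_transform_def)
    \<comment> \<open>To cancel \<open>G s\<close>, numerator and denominator must both be nonzero:
      \<open>Gamma\<close> is 0 at its poles and division by 0 gives 0, so a vanishing denominator
      would make \<open>G s\<close> vanish as well.\<close>
    moreover have "Gamma (s + complex_of_real (a j)) \<noteq> 0" if "j \<in> {1..p}" for j
      using a_gt[OF s that] by (intro Gamma_add_of_nat(2)) simp
    moreover have "Gamma (s + complex_of_real (c j)) \<noteq> 0" if "j \<in> {1..q}" for j
      using b_gt[OF s that] by (intro Gamma_add_of_nat(2)) (simp add: c_def)
    ultimately show ?thesis by (auto simp: G_def w0_transform_def s_def)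
  qed
  from real_poly_fun_zeros[OF f this]
  obtain C where C: "\<And>s. f s = complex_of_real C * pochhammer (1 - s) (N - 1)" by blast
  show ?thesis
  proof (intro exI[of _ C] allI impI)
    fix s :: complex assume "Re s > - Min (a ` {1..p})"
    hence "has_mellin_transform F s (G s * f s)" using mellin by (simp add: \<alpha>_def)
    moreover have "G s = (\<Prod>j=1..p. Gamma (s + complex_of_real (a j)))
          / (\<Prod>j=1..q. Gamma (s + complex_of_real (b j) + of_nat (n j)))"
      by (simp add: G_def w0_transform_def c_def add.assoc)
    ultimately show "has_mellin_transform F s
      (complex_of_real C
       * ((\<Prod>j=1..p. Gamma (s + complex_of_real (a j)))
          / (\<Prod>j=1..q. Gamma (s + complex_of_real (b j) + of_nat (n j))))
       * pochhammer (1 - s) ((\<Sum>j=1..q. n j) + (\<Sum>j=1..p-q. m j) - 1))"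
      unfolding C N_def [symmetric] by (simp add: mult_ac)
  qed
qed

end
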